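(* Let $P$ be a finite poset and $\ell$ a linear extension of $P$, and let ${\operatorname{Stab}}(\ell)$ be its stabilizer in $\mathcal{BK}_P$. If $\mathfrak{s}_P\notin\{6,12,36\}$ and $\mathfrak{s}_P$ is not a power of $2$, then ${\operatorname{Stab}}(\ell)$ contains a subgroup isomorphic to $(\mathbb{Z}/2\mathbb{Z})^2\times{\mathfrak{S}}_3$ or a subgroup isomorphic to ${\mathfrak{S}}_4$. In particular, $\mathfrak{s}_P\in\{6,12,36\}$, or $\mathfrak{s}_P$ is a power of $2$, or $24\mid\mathfrak{s}_P$.
   Context: For an $n$-element poset $P$, a linear extension is a list $(p_1,\dots,p_n)$ of all elements with $p_a<_P p_b$ implying $a<b$; ${\mathcal{L}}(P)$ is the set of these. The Bender--Knuth move $t_i$ ($1\le i\le n-1$) acts on ${\mathcal{L}}(P)$ by swapping $p_i,p_{i+1}$ if incomparable and fixing the list otherwise; $\mathcal{BK}_P$ is the subgroup of the symmetric group on ${\mathcal{L}}(P)$ they generate (it acts transitively on ${\mathcal{L}}(P)$). The stabilizer size of $P$ is $\mathfrak{s}_P=|\mathcal{BK}_P|/|{\mathcal{L}}(P)|$. *)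

theory Defs
  imports
    Complex_Main
    "HOL-Algebra.Group_Action"
    "HOL-Algebra.Elementary_Groups"
    "HOL-Algebra.Sym_Groups"
begin

text \<open>
  A poset is a carrier \<open>P\<close> with a reflexive order relation \<open>r\<close>
  such that \<open>partial_order_on P r\<close>; the empty poset is allowed.
\<close>

definition linear_extensions :: "'a set \<Rightarrow> ('a \<times> 'a) set \<Rightarrow> 'a list set" where
  "linear_extensions P r =
     {xs. distinct xs \<and> set xs = P \<and>
          (\<forall>a<length xs. \<forall>b<length xs.
             (xs ! a, xs ! b) \<in> r \<and> xs ! a \<noteq> xs ! b \<longrightarrow> a < b)}"

text \<open>
  Positions in a list count from 0 here, so \<open>bender_knuth P r i\<close> is the move usually
  written \<open>t\<^sub>j\<close> with \<open>j = Suc i\<close>. It is restricted to the linear extensions because elements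
  of the library's group \<^const>\<open>BijGroup\<close> are extensional functions.
\<close>

definition bender_knuth :: "'a set \<Rightarrow> ('a \<times> 'a) set \<Rightarrow> nat \<Rightarrow> 'a list \<Rightarrow> 'a list" where
  "bender_knuth P r i =
     (\<lambda>xs \<in> linear_extensions P r.
        if (xs ! i, xs ! Suc i) \<notin> r \<and> (xs ! Suc i, xs ! i) \<notin> r
        then xs[i := xs ! Suc i, Suc i := xs ! i]
        else xs)"

definition BK_group :: "'a set \<Rightarrow> ('a \<times> 'a) set \<Rightarrow> ('a list \<Rightarrow> 'a list) monoid" where
  "BK_group P r =
     subgroup_generated (BijGroup (linear_extensions P r))
       {bender_knuth P r i | i. Suc i < card P}"

definition BK_Stab ::
  "'a set \<Rightarrow> ('a \<times> 'a) set \<Rightarrow> 'a list \<Rightarrow> ('a list \<Rightarrow> 'a list) monoid" where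
  "BK_Stab P r l =
     (BK_group P r)\<lparr>carrier := stabilizer (BK_group P r) (\<lambda>g. g) l\<rparr>"

text \<open>
  The stabilizer size is defined as an exact quotient; that it is an integer is a consequence
  of the transitivity of the action.
\<close>

definition stabilizer_size :: "'a set \<Rightarrow> ('a \<times> 'a) set \<Rightarrow> rat" where
  "stabilizer_size P r =
     of_nat (order (BK_group P r)) / of_nat (card (linear_extensions P r))"

definition has_subgroup_iso_to ::
  "('a, 'c) monoid_scheme \<Rightarrow> ('b, 'd) monoid_scheme \<Rightarrow> bool" where
  "has_subgroup_iso_to G K \<longleftrightarrow> (\<exists>H. subgroup H G \<and> G\<lparr>carrier := H\<rparr> \<cong> K)"

text \<open>
  The library operator \<^const>\<open>subgroup_generated\<close> discards generators outside the ambient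
  group. The following lemmas show that no Bender--Knuth move is discarded.
\<close>

lemma bender_knuth_in_linear_extensions:
  assumes l: "xs \<in> linear_extensions P r" and i: "Suc i < card P"
  shows "bender_knuth P r i xs \<in> linear_extensions P r"
proof (cases "(xs ! i, xs ! Suc i) \<notin> r \<and> (xs ! Suc i, xs ! i) \<notin> r")
  case True
  define ys where "ys = xs[i := xs ! Suc i, Suc i := xs ! i]"
  have d: "distinct xs" and s: "set xs = P"
    and o: "\<And>a b. \<lbrakk>a < length xs; b < length xs; (xs ! a, xs ! b) \<in> r; xs ! a \<noteq> xs ! b\<rbrakk> \<Longrightarrow> a < b"
    using l by (auto simp: linear_extensions_def)
  have n: "Suc i < length xs"
    using i d s distinct_card by fastforce
  have len: "length ys = length xs"
    by (simp add: ys_def)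
  have nth: "ys ! a = xs ! (if a = i then Suc i else if a = Suc i then i else a)"
    if "a < length xs" for a
    using n that by (auto simp: ys_def nth_list_update)
  have "a < b" if "a < length ys" "b < length ys" "(ys ! a, ys ! b) \<in> r" "ys ! a \<noteq> ys ! b" for a b
  proof -
    let ?t = "\<lambda>a. if a = i then Suc i else if a = Suc i then i else a"
    have r: "(xs ! ?t a, xs ! ?t b) \<in> r" and ne: "xs ! ?t a \<noteq> xs ! ?t b"
      using that nth len by metis+
    have "?t a < ?t b"
      by (rule o) (use r ne that n len in auto)
    then show ?thesis
      using r True by (auto split: if_splits)
  qed
  moreover have "distinct ys" "set ys = P"
    using n d s by (simp_all add: ys_def)
  ultimately have "ys \<in> linear_extensions P r"
    by (simp add: linear_extensions_def)
  then show ?thesis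
    using True l by (simp add: bender_knuth_def ys_def)
qed (use l in \<open>auto simp: bender_knuth_def\<close>)

lemma bender_knuth_involution:
  assumes l: "xs \<in> linear_extensions P r" and i: "Suc i < card P"
  shows "bender_knuth P r i (bender_knuth P r i xs) = xs"
proof (cases "(xs ! i, xs ! Suc i) \<notin> r \<and> (xs ! Suc i, xs ! i) \<notin> r")
  case True
  have "Suc i < length xs"
    using i l distinct_card by (fastforce simp: linear_extensions_def)
  moreover have "bender_knuth P r i xs = xs[i := xs ! Suc i, Suc i := xs ! i]"
    using True l by (simp add: bender_knuth_def)
  ultimately show ?thesis
    using True bender_knuth_in_linear_extensions[OF l i]
    by (auto simp: bender_knuth_def nth_list_update list_eq_iff_nth_eq)
qed (use l in \<open>auto simp: bender_knuth_def\<close>)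

lemma bender_knuth_in_BijGroup:
  assumes "Suc i < card P"
  shows "bender_knuth P r i \<in> carrier (BijGroup (linear_extensions P r))"
proof -
  have "bij_betw (bender_knuth P r i) (linear_extensions P r) (linear_extensions P r)"
    by (rule bij_betw_byWitness[where f' = "bender_knuth P r i"])
      (auto simp: assms bender_knuth_involution bender_knuth_in_linear_extensions)
  moreover have "bender_knuth P r i \<in> extensional (linear_extensions P r)"
    by (simp add: bender_knuth_def)
  ultimately show ?thesis
    by (simp add: BijGroup_def Bij_def)
qed

lemma carrier_BK_group:
  "carrier (BK_group P r) =
     generate (BijGroup (linear_extensions P r)) {bender_knuth P r i | i. Suc i < card P}"
proof -
  have "carrier (BijGroup (linear_extensions P r)) \<inter> {bender_knuth P r i | i. Suc i < card P}
      = {bender_knuth P r i | i. Suc i < card P}"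
    using bender_knuth_in_BijGroup by blast
  then show ?thesis
    by (simp add: BK_group_def carrier_subgroup_generated)
qed

end

theory Submission
  imports Defs
begin

text \<open>
  Call four consecutive elements \<open>a b c d\<close> of a linear extension a bad window if their order is
  \<open>a < c, b < c, b < d\<close> (the N), \<open>b < c, b < d\<close> (a V and an isolated point) or \<open>a < c, b < c\<close> (its dual).
  For each of the three types there are words in the three moves acting inside a window which fix
  a bad window of that type and which satisfy the Coxeter relations of \<open>\<SS>\<^sub>4\<close> on every
  window whatsoever. Since a move depends only on the window it acts in, these words generate a copy
  of \<open>\<SS>\<^sub>4\<close> in a stabilizer as soon as one bad window occurs, and all stabilizers are
  conjugate by transitivity.

  If no bad window occurs, then consecutive elements \<open>x < y, x < z\<close> with \<open>y, z\<close>
  incomparable force everything up to \<open>x\<close> to lie below everything after \<open>x\<close>, because any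
  exception could be moved next to the three elements to form a bad window; dually for
  \<open>x > y, x > z\<close>. So the poset is an ordinal sum of disjoint unions of chains, and
  the stabilizer is the group of permutations of the positions that preserve these chains. It is
  thus a product of symmetric groups, one for each chain.
\<close>

section \<open>A Coxeter presentation of the symmetric group on four letters\<close>

text \<open>Relations are needed on every window because a group element permutes all linear
  extensions. Whether a move acts depends only on comparability, which makes this a finite check. On
  the bad window the words act trivially, so faithfulness has to be seen elsewhere. One neighbouring
  extension suffices: a nontrivial normal subgroup of the symmetric group on four letters contains
  the product of the two commuting generators, so the map is injective as soon as these two differ.

  Without bad windows the obstacle is that a move does nothing to comparable entries and so is no
  transposition of positions. On words of chain labels it is one: where the move is not the
  identity, comparable neighbours belong to the same chain, and exchanging equal labels changes
  nothing.

  The exceptional sizes come from chains of at most three elements: a factor 6 tolerates one further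
  factor 2 or 6, while two further ones already give a subgroup of order 24.\<close>

lemma has_subgroup_iso_toI:
  assumes "group T" "group G" "h \<in> hom T G" "inj_on h (carrier T)"
  shows "has_subgroup_iso_to G T"
proof -
  interpret group_hom T G h
    using assms by (simp add: group_hom_def group_hom_axioms_def)
  have "subgroup (h ` carrier T) G"
    by (rule img_is_subgroup)
  moreover have "h \<in> iso T (G\<lparr>carrier := h ` carrier T\<rparr>)"
    using assms by (auto simp: iso_def hom_def bij_betw_def)
  ultimately show ?thesis
    unfolding has_subgroup_iso_to_def is_iso_def
    using assms(1) group.iso_sym is_isoI by (metis is_iso_def)
qed

section \<open>Normal forms of words in the three adjacent transpositions\<close>

fun word_mult :: "('b, 'c) monoid_scheme \<Rightarrow> (nat \<Rightarrow> 'b) \<Rightarrow> nat list \<Rightarrow> 'b" where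
  "word_mult G s [] = \<one>\<^bsub>G\<^esub>"
| "word_mult G s (j # w) = s j \<otimes>\<^bsub>G\<^esub> word_mult G s w"

text \<open>One factor for each step from 2 to 3 to 4 letters: \<open>b\<close> and \<open>c\<close>
  run through shortest coset representatives, which gives 2 * 3 * 4 = 24 words, one per
  permutation.\<close>

definition s4_words :: "nat list list" where
  "s4_words = [a @ b @ c. a \<leftarrow> [[], [0]], b \<leftarrow> [[], [1], [1, 0]], c \<leftarrow> [[], [2], [2, 1], [2, 1, 0]]]"

definition swap_at :: "nat \<Rightarrow> 'b list \<Rightarrow> 'b list" where
  "swap_at j xs = xs[j := xs ! Suc j, Suc j := xs ! j]"

lemma length_swap_at [simp]: "length (swap_at j xs) = length xs"
  by (simp add: swap_at_def)

lemma length_fold_swap_at [simp]: "length (fold swap_at w xs) = length xs"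
  by (induction w arbitrary: xs) auto

text \<open>Swapping positions and renaming entries multiply a permutation from opposite sides,
  hence they commute.\<close>

lemma fold_swap_at_map:
  assumes "\<forall>j\<in>set w. Suc j < length xs"
  shows "fold swap_at w (map f xs) = map f (fold swap_at w xs)"
proof -
  have swap_at_map: "swap_at j (map f xs) = map f (swap_at j xs)" if "Suc j < length xs" for j xs
    using that by (simp add: swap_at_def map_update)
  show ?thesis
    using assms by (induction w arbitrary: xs) (simp_all add: swap_at_map)
qed

text \<open>
  Swapping positions multiplies a permutation by a transposition from the right, so a word read from
  left to right is turned into the product that \<open>word_mult\<close> forms.
\<close>

abbreviation word_perm :: "nat list \<Rightarrow> nat list" where
  "word_perm w \<equiv> fold swap_at w [1,2,3,4]"

definition s4_nf :: "nat list \<Rightarrow> nat list" where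
  "s4_nf xs = hd (filter (\<lambda>w. word_perm w = xs) s4_words)"

lemma s4_nf_list:
  "\<forall>a\<in>{1,2,3,4}. \<forall>b\<in>{1,2,3,4}. \<forall>c\<in>{1,2,3,4}. \<forall>d\<in>{1,2,3,4}. distinct [a,b,c,d] \<longrightarrow>
     s4_nf [a,b,c,d] \<in> set s4_words \<and> word_perm (s4_nf [a,b,c,d]) = [a,b,c,d]"
  by code_simp

lemma s4_words_letters: "w \<in> set s4_words \<Longrightarrow> set w \<subseteq> {0,1,2}"
  by (auto simp: s4_words_def)

lemma s4_words_eq: "s4_words = [[], [2], [2, 1], [2, 1, 0], [1], [1, 2], [1, 2, 1], [1, 2, 1, 0],
   [1, 0], [1, 0, 2], [1, 0, 2, 1], [1, 0, 2, 1, 0], [0], [0, 2], [0, 2, 1], [0, 2, 1, 0], [0, 1],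
   [0, 1, 2], [0, 1, 2, 1], [0, 1, 2, 1, 0], [0, 1, 0], [0, 1, 0, 2], [0, 1, 0, 2, 1], [0, 1, 0, 2, 1, 0]]"
  by code_simp

text \<open>The table of right multiplication by the generators, with rows in the order of
  \<open>s4_words_eq\<close>. It separates the evaluation of permutations from the rewriting in an
  arbitrary group.\<close>

lemma s4_nf_append:
  "map (\<lambda>w. map (\<lambda>j. s4_nf (swap_at j (word_perm w))) [0,1,2]) s4_words = 
  [[[0], [1], [2]],
   [[0, 2], [2, 1], []],
   [[2, 1, 0], [2], [1, 2, 1]],
   [[2, 1], [0, 2, 1, 0], [1, 2, 1, 0]],
   [[1, 0], [], [1, 2]],
   [[1, 0, 2], [1, 2, 1], [1]],
   [[1, 2, 1, 0], [1, 2], [2, 1]],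
   [[1, 2, 1], [1, 0, 2, 1, 0], [2, 1, 0]],
   [[1], [0, 1, 0], [1, 0, 2]],
   [[1, 2], [1, 0, 2, 1], [1, 0]],
   [[1, 0, 2, 1, 0], [1, 0, 2], [0, 1, 0, 2, 1]],
   [[1, 0, 2, 1], [1, 2, 1, 0], [0, 1, 0, 2, 1, 0]],
   [[], [0, 1], [0, 2]],
   [[2], [0, 2, 1], [0]],
   [[0, 2, 1, 0], [0, 2], [0, 1, 2, 1]],
   [[0, 2, 1], [2, 1, 0], [0, 1, 2, 1, 0]],
   [[0, 1, 0], [0], [0, 1, 2]],
   [[0, 1, 0, 2], [0, 1, 2, 1], [0, 1]],
   [[0, 1, 2, 1, 0], [0, 1, 2], [0, 2, 1]],
   [[0, 1, 2, 1], [0, 1, 0, 2, 1, 0], [0, 2, 1, 0]],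
   [[0, 1], [1, 0], [0, 1, 0, 2]],
   [[0, 1, 2], [0, 1, 0, 2, 1], [0, 1, 0]],
   [[0, 1, 0, 2, 1, 0], [0, 1, 0, 2], [1, 0, 2, 1]],
   [[0, 1, 0, 2, 1], [0, 1, 2, 1, 0], [1, 0, 2, 1, 0]]]"
  by code_simp

section \<open>Elements satisfying the Coxeter relations of type A3\<close>

locale coxeter_A3 = group G for G (structure) +
  fixes s :: "nat \<Rightarrow> 'a"
  assumes s_closed [simp]: "s j \<in> carrier G"
    and involution: "s j \<otimes> s j = \<one>"
    and braid_01: "s 1 \<otimes> (s 0 \<otimes> s 1) = s 0 \<otimes> (s 1 \<otimes> s 0)"
    and braid_12: "s 2 \<otimes> (s 1 \<otimes> s 2) = s 1 \<otimes> (s 2 \<otimes> s 1)"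
    and commute_02: "s 2 \<otimes> s 0 = s 0 \<otimes> s 2"
begin

lemma word_mult_closed [simp]: "word_mult G s w \<in> carrier G"
  by (induction w) auto

lemma word_mult_append:
  "word_mult G s (u @ w) = word_mult G s u \<otimes> word_mult G s w"
  by (induction u) (auto simp: m_assoc)

text \<open>
  With this relation the defining ones form a complete rewriting system, whose normal forms are
  \<open>s4_words\<close>.
\<close>

lemma braid_2102: "s 2 \<otimes> (s 1 \<otimes> (s 0 \<otimes> s 2)) = s 1 \<otimes> (s 2 \<otimes> (s 1 \<otimes> s 0))"
  using braid_12 commute_02 by (metis m_assoc s_closed m_closed)

lemma relations_extended:
  assumes u: "u \<in> carrier G"
  shows "s j \<otimes> (s j \<otimes> u) = u"
    and "s 1 \<otimes> (s 0 \<otimes> (s 1 \<otimes> u)) = s 0 \<otimes> (s 1 \<otimes> (s 0 \<otimes> u))"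
    and "s 2 \<otimes> (s 1 \<otimes> (s 2 \<otimes> u)) = s 1 \<otimes> (s 2 \<otimes> (s 1 \<otimes> u))"
    and "s 2 \<otimes> (s 0 \<otimes> u) = s 0 \<otimes> (s 2 \<otimes> u)"
    and "s 2 \<otimes> (s 1 \<otimes> (s 0 \<otimes> (s 2 \<otimes> u))) = s 1 \<otimes> (s 2 \<otimes> (s 1 \<otimes> (s 0 \<otimes> u)))"
proof -
  show "s j \<otimes> (s j \<otimes> u) = u"
    using involution[of j] u by (metis m_assoc l_one s_closed)
  show "s 1 \<otimes> (s 0 \<otimes> (s 1 \<otimes> u)) = s 0 \<otimes> (s 1 \<otimes> (s 0 \<otimes> u))"
    using arg_cong[OF braid_01, of "\<lambda>x. x \<otimes> u"] u by (simp add: m_assoc)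
  show "s 2 \<otimes> (s 1 \<otimes> (s 2 \<otimes> u)) = s 1 \<otimes> (s 2 \<otimes> (s 1 \<otimes> u))"
    using arg_cong[OF braid_12, of "\<lambda>x. x \<otimes> u"] u by (simp add: m_assoc)
  show "s 2 \<otimes> (s 0 \<otimes> u) = s 0 \<otimes> (s 2 \<otimes> u)"
    using arg_cong[OF commute_02, of "\<lambda>x. x \<otimes> u"] u by (simp add: m_assoc)
  show "s 2 \<otimes> (s 1 \<otimes> (s 0 \<otimes> (s 2 \<otimes> u))) = s 1 \<otimes> (s 2 \<otimes> (s 1 \<otimes> (s 0 \<otimes> u)))"
    using arg_cong[OF braid_2102, of "\<lambda>x. x \<otimes> u"] u by (simp add: m_assoc)
qed

lemmas rewrite_rules = involution braid_01 braid_12 commute_02 braid_2102 relations_extended m_assoc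

text \<open>By the table this amounts to 72 identities between words; the relations, used as rewrite
  rules, bring both sides to the same form.\<close>

lemma word_mult_nf_step:
  assumes "w \<in> set s4_words" "j \<in> {0,1,2}"
  shows "word_mult G s w \<otimes> s j = word_mult G s (s4_nf (swap_at j (word_perm w)))"
proof -
  have "\<forall>w\<in>set s4_words. \<forall>j\<in>{0,1,2}.
    word_mult G s w \<otimes> s j = word_mult G s (s4_nf (swap_at j (word_perm w)))"
    using s4_nf_append unfolding s4_words_eq 
    by (simp add: rewrite_rules flip: One_nat_def del: fold_simps)
  then show ?thesis
    using assms by blast
qed

text \<open>Each appended letter moves the normal form by one entry of the table. Hence the product
  in the group depends only on the permutation of the word, which makes \<open>from_sym\<close>
  multiplicative.\<close>

lemma word_mult_nf:
  assumes "set w \<subseteq> {0,1,2}"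
  shows "s4_nf (word_perm w) \<in> set s4_words \<and>
    word_perm (s4_nf (word_perm w)) = word_perm w \<and>
    word_mult G s (s4_nf (word_perm w)) = word_mult G s w"
  using assms
proof (induction w rule: rev_induct)
  case Nil
  have "s4_nf [1,2,3,4] = [] \<and> [] \<in> set s4_words"
    by code_simp
  then show ?case
    by simp
next
  case (snoc j w)
  let ?n = "s4_nf (word_perm w)"
  have IH: "?n \<in> set s4_words" "word_perm ?n = word_perm w"
    "word_mult G s ?n = word_mult G s w" and j: "j \<in> {0,1,2}"
    using snoc by auto
  have "\<forall>n\<in>set s4_words. \<forall>j\<in>{0,1,2}. s4_nf (swap_at j (word_perm n)) \<in> set s4_words \<and>
    word_perm (s4_nf (swap_at j (word_perm n))) = swap_at j (word_perm n)"
    by code_simp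
  then have "s4_nf (swap_at j (word_perm ?n)) \<in> set s4_words"
    "word_perm (s4_nf (swap_at j (word_perm ?n))) = swap_at j (word_perm ?n)"
    using IH(1) j by blast+
  moreover have "word_mult G s ?n \<otimes> s j = word_mult G s (s4_nf (swap_at j (word_perm ?n)))"
    using IH(1) j by (rule word_mult_nf_step)
  ultimately show ?case
    unfolding IH by (simp add: word_mult_append)
qed

lemma word_mult_conjugate_eq_one:
  assumes "word_mult G s w = \<one>"
  shows "word_mult G s (u @ w @ rev u) = \<one>"
proof -
  have "word_mult G s (u @ rev u) = \<one>"
  proof (induction u)
    case (Cons j u)
    then show ?case
      using word_mult_append[of "u @ rev u" "[j]"] by (simp add: involution)
  qed simp
  then show ?thesis
    using assms by (simp add: word_mult_append)
qed

text \<open>Triviality of a word passes to its conjugates, so one representative per conjugacy class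
  has to be excluded. If any of them were trivial, the relations would force
  \<open>s 0 = s 2\<close>.\<close>

lemma word_mult_eq_one:
  assumes w: "w \<in> set s4_words" "word_mult G s w = \<one>" and ne: "s 0 \<noteq> s 2"
  shows "w = []"
proof -
  have inv_eq: "x = y" if "x \<otimes> y = \<one>" "y \<otimes> y = \<one>" "x \<in> carrier G" "y \<in> carrier G" for x y
    using that by (metis inv_unique' inv_equality)
  have 02: "s 0 \<otimes> s 2 \<noteq> \<one>"
    using ne inv_eq involution by auto
  have 0: "s 0 \<noteq> \<one>"
  proof
    assume "s 0 = \<one>"
    moreover from this have "s 1 = \<one>"
      using braid_01 involution by simp
    moreover from this have "s 2 = \<one>"
      using braid_12 involution by simp
    ultimately show False
      using ne by simp
  qed
  have 01: "s 0 \<otimes> s 1 \<noteq> \<one>"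
  proof
    assume "s 0 \<otimes> s 1 = \<one>"
    then have "s 1 = s 0"
      using inv_eq involution by force
    then have "s 0 = s 2"
      using braid_12 commute_02 involution
      by (metis l_one m_assoc r_one s_closed)
    then show False
      using ne by simp
  qed
  have 012: "s 0 \<otimes> (s 1 \<otimes> s 2) \<noteq> \<one>"
  proof
    assume "s 0 \<otimes> (s 1 \<otimes> s 2) = \<one>"
    then have "s 0 = s 1 \<otimes> s 2"
      by (metis involution l_one m_assoc m_closed s_closed r_one)
    then show False
      using 01 braid_01 commute_02 involution 
      by (metis l_one m_assoc r_one s_closed m_closed)
  qed
  have conj: "word_mult G s (u @ w @ rev u) = \<one>" for u
    using w(2) by (rule word_mult_conjugate_eq_one)
  \<comment> \<open>The four targets are a transposition, a 3-cycle, a 4-cycle and a double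
    transposition: all nontrivial conjugacy classes.\<close>
  have conjugate_rep: "\<forall>w\<in>set s4_words. w \<noteq> [] \<longrightarrow> (\<exists>u\<in>set s4_words.
      s4_nf (word_perm (u @ w @ rev u)) \<in> {[0], [0,1], [0,1,2], [0,2]})"
    by code_simp
  show ?thesis
  proof (rule ccontr)
    assume "w \<noteq> []"
    then obtain u where u: "u \<in> set s4_words"
      "s4_nf (word_perm (u @ w @ rev u)) \<in> {[0], [0,1], [0,1,2], [0,2]}"
      using conjugate_rep w(1) by blast
    have "set (u @ w @ rev u) \<subseteq> {0,1,2}"
      using s4_words_letters u(1) w(1) by auto
    then have "word_mult G s (s4_nf (word_perm (u @ w @ rev u))) = \<one>"
      using conj[of u] word_mult_nf by metis
    then show False
      using u(2) 0 01 012 02 by auto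
  qed
qed

definition from_sym :: "(nat \<Rightarrow> nat) \<Rightarrow> 'a" where
  "from_sym p = word_mult G s (s4_nf (map p [1,2,3,4]))"

lemma permutes_nf:
  assumes "p permutes {1..4}"
  shows "s4_nf (map p [1,2,3,4]) \<in> set s4_words"
    and "word_perm (s4_nf (map p [1,2,3,4])) = map p [1,2,3,4]"
proof -
  have "p i \<in> {1,2,3,4}" if "i \<in> {1,2,3,4}" for i
    using permutes_in_image[OF assms, of i] that by auto
  moreover have "distinct (map p [1,2,3,4])"
    using permutes_inj[OF assms] by (auto simp: inj_eq)
  ultimately show "s4_nf (map p [1,2,3,4]) \<in> set s4_words"
    and "word_perm (s4_nf (map p [1,2,3,4])) = map p [1,2,3,4]"
    using s4_nf_list[rule_format, of "p 1" "p 2" "p 3" "p 4"] by auto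
qed

lemma from_sym_hom: "from_sym \<in> hom (sym_group 4) G"
proof (rule homI)
  fix p q
  assume "p \<in> carrier (sym_group 4)" "q \<in> carrier (sym_group 4)"
  then have p: "p permutes {1..4}" and q: "q permutes {1..4}"
    by (auto simp: sym_group_def)
  let ?u = "s4_nf (map p [1,2,3,4])" and ?v = "s4_nf (map q [1,2,3,4])"
  have letters: "set ?u \<subseteq> {0,1,2}" "set ?v \<subseteq> {0,1,2}"
    using permutes_nf(1) p q s4_words_letters by blast+
  have "\<forall>j\<in>set ?v. Suc j < length [1,2,3,4::nat]"
    using letters(2) by auto
  \<comment> \<open>Started from the arrangement of \<open>p\<close>, the word \<open>?v\<close>
    yields the arrangement of \<open>q\<close> with entries renamed by \<open>p\<close>, that is
    \<open>p \<circ> q\<close>.\<close>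
  note fold_swap_at_map[OF this, of p]
  then have "word_perm (?u @ ?v) = map (p \<circ> q) [1,2,3,4]"
    using permutes_nf(2)[OF p] permutes_nf(2)[OF q]
    by simp
  then have "from_sym (p \<circ> q) = word_mult G s (?u @ ?v)"
    using word_mult_nf[of "?u @ ?v"] letters by (simp add: from_sym_def)
  then show "from_sym (p \<otimes>\<^bsub>sym_group 4\<^esub> q) = from_sym p \<otimes> from_sym q"
    by (simp add: word_mult_append from_sym_def sym_group_def)
qed (simp add: from_sym_def)

lemma has_subgroup_sym_group_4:
  assumes "s 0 \<noteq> s 2"
  shows "has_subgroup_iso_to G (sym_group 4)"
proof (rule has_subgroup_iso_toI)
  interpret group_hom "sym_group 4" G from_sym
    using from_sym_hom sym_group_is_group
    by (simp add: group_hom_def group_hom_axioms_def is_group)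
  have "p = id" if p: "p permutes {1..4}" and "from_sym p = \<one>" for p
  proof -
    have "s4_nf (map p [1,2,3,4]) = []"
      using word_mult_eq_one[OF permutes_nf(1)[OF p]] that assms by (simp add: from_sym_def)
    then have fix4: "map p [1,2,3,4] = [1,2,3,4]"
      using permutes_nf(2)[OF p] by simp
    have "p i = i" for i
    proof (cases "i \<in> {1..4}")
      case True
      then have "i = 1 \<or> i = 2 \<or> i = 3 \<or> i = 4"
        by auto
      then show ?thesis
        using fix4 by auto
    qed (use p in \<open>auto simp: permutes_def\<close>)
    then show ?thesis
      by auto
  qed
  then show "inj_on from_sym (carrier (sym_group 4))"
    by (subst inj_on_one_iff) (auto simp: sym_group_def)
qed (use from_sym_hom sym_group_is_group is_group in auto)

end

section \<open>Transitivity of Bender--Knuth moves\<close>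

text \<open>In this form the order condition splits along appended lists and survives filtering and
  reversal, the operations by which extensions are rearranged below.\<close>

lemma linear_extensions_iff_sorted_wrt:
  "xs \<in> linear_extensions P r \<longleftrightarrow>
     distinct xs \<and> set xs = P \<and> sorted_wrt (\<lambda>x y. (y, x) \<notin> r) xs"
proof -
  have "(\<forall>a<length xs. \<forall>b<length xs. (xs ! a, xs ! b) \<in> r \<and> xs ! a \<noteq> xs ! b \<longrightarrow> a < b)
    \<longleftrightarrow> sorted_wrt (\<lambda>x y. (y, x) \<notin> r) xs" if d: "distinct xs"
  proof
    assume *: "\<forall>a<length xs. \<forall>b<length xs. (xs ! a, xs ! b) \<in> r \<and> xs ! a \<noteq> xs ! b \<longrightarrow> a < b"
    show "sorted_wrt (\<lambda>x y. (y, x) \<notin> r) xs"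
      unfolding sorted_wrt_iff_nth_less
    proof (intro allI impI notI)
      fix i j
      assume "i < j" "j < length xs" "(xs ! j, xs ! i) \<in> r"
      then show False
        using *[rule_format, of j i] d by (auto simp: nth_eq_iff_index_eq)
    qed
  next
    assume *: "sorted_wrt (\<lambda>x y. (y, x) \<notin> r) xs"
    show "\<forall>a<length xs. \<forall>b<length xs. (xs ! a, xs ! b) \<in> r \<and> xs ! a \<noteq> xs ! b \<longrightarrow> a < b"
      using * unfolding sorted_wrt_iff_nth_less by (metis linorder_neqE_nat)
  qed
  then show ?thesis
    by (auto simp: linear_extensions_def)
qed

text \<open>Not restricted to linear extensions, so that it also acts on a segment of a
  list.\<close>

definition bk_step :: "('a \<times> 'a) set \<Rightarrow> nat \<Rightarrow> 'a list \<Rightarrow> 'a list" where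
  "bk_step r j xs = (if (xs ! j, xs ! Suc j) \<notin> r \<and> (xs ! Suc j, xs ! j) \<notin> r
     then swap_at j xs else xs)"

lemma length_bk_step [simp]: "length (bk_step r j xs) = length xs"
  by (simp add: bk_step_def)

lemma length_fold_bk_step [simp]: "length (fold (bk_step r) w xs) = length xs"
  by (induction w arbitrary: xs) auto

lemma bender_knuth_eq_bk_step:
  "bender_knuth P r i = restrict (bk_step r i) (linear_extensions P r)"
  by (auto simp: bender_knuth_def bk_step_def swap_at_def)

lemma bk_step_append:
  assumes "Suc j < length ws"
  shows "bk_step r (length us + j) (us @ ws @ vs) = us @ bk_step r j ws @ vs"
  using assms by (simp add: bk_step_def swap_at_def nth_append list_update_append)

lemma fold_bk_step_append:
  assumes "\<forall>j\<in>set w. Suc j < length ws"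
  shows "fold (bk_step r) (map ((+) (length us)) w) (us @ ws @ vs) = us @ fold (bk_step r) w ws @ vs"
  using assms by (induction w arbitrary: ws) (simp_all add: bk_step_append)

locale finite_poset =
  fixes P :: "'a set" and r :: "('a \<times> 'a) set"
  assumes finite_P: "finite P" and partial_order: "partial_order_on P r"
begin

abbreviation L :: "'a list set" where "L \<equiv> linear_extensions P r"
abbreviation G :: "('a list \<Rightarrow> 'a list) monoid" where "G \<equiv> BK_group P r"

lemma refl: "x \<in> P \<Longrightarrow> (x, x) \<in> r"
  using partial_order by (auto simp: order_on_defs refl_on_def)

lemma trans: "(x, y) \<in> r \<Longrightarrow> (y, z) \<in> r \<Longrightarrow> (x, z) \<in> r"
  using partial_order unfolding order_on_defs by (meson transD)

lemma antisym: "(x, y) \<in> r \<Longrightarrow> (y, x) \<in> r \<Longrightarrow> x = y"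
  using partial_order unfolding order_on_defs by (meson antisymD)

lemma in_carrier: "(x, y) \<in> r \<Longrightarrow> x \<in> P" "(x, y) \<in> r \<Longrightarrow> y \<in> P"
  using partial_order unfolding order_on_defs by blast+

lemma length_extension: "xs \<in> L \<Longrightarrow> length xs = card P"
  by (metis distinct_card linear_extensions_iff_sorted_wrt)

lemma finite_L: "finite L"
proof (rule finite_subset)
  show "L \<subseteq> {xs. set xs \<subseteq> P \<and> length xs = card P}"
    using length_extension by (auto simp: linear_extensions_iff_sorted_wrt)
qed (simp add: finite_P finite_lists_length_eq)

lemma bk_step_in_L:
  assumes "xs \<in> L" "Suc j < card P"
  shows "bk_step r j xs \<in> L"
  using bender_knuth_in_linear_extensions[OF assms] assms(1)
  by (simp add: bender_knuth_eq_bk_step)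

lemma fold_bk_step_in_L:
  assumes "xs \<in> L" "\<forall>j\<in>set w. Suc j < card P"
  shows "fold (bk_step r) w xs \<in> L"
  using assms by (induction w arbitrary: xs) (auto intro: bk_step_in_L)

definition bk_elt :: "nat list \<Rightarrow> 'a list \<Rightarrow> 'a list" where
  "bk_elt w = restrict (fold (bk_step r) w) L"

lemma group_G: "group G"
  by (simp add: BK_group_def group.group_subgroup_generated group_BijGroup)

lemma carrier_G_subset: "carrier G \<subseteq> carrier (BijGroup L)"
  by (simp add: BK_group_def group.carrier_subgroup_generated_subset group_BijGroup)

lemma in_L: "g \<in> carrier G \<Longrightarrow> xs \<in> L \<Longrightarrow> g xs \<in> L"
  using carrier_G_subset by (auto simp: BijGroup_def Bij_def bij_betw_def)

lemma mult_G: 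
  assumes "g \<in> carrier G" "h \<in> carrier G"
  shows "g \<otimes>\<^bsub>G\<^esub> h = compose L g h"
  using assms carrier_G_subset by (auto simp: BK_group_def BijGroup_def)

lemma one_G: "\<one>\<^bsub>G\<^esub> = restrict id L"
  by (auto simp: BK_group_def BijGroup_def)

lemma eq_in_G:
  assumes "g \<in> carrier G" "h \<in> carrier G" "\<And>xs. xs \<in> L \<Longrightarrow> g xs = h xs"
  shows "g = h"
proof (rule extensionalityI)
  show "g \<in> extensional L" "h \<in> extensional L"
    using assms(1,2) carrier_G_subset by (auto simp: BijGroup_def Bij_def)
qed (use assms(3) in auto)

lemma bender_knuth_in_G: "Suc i < card P \<Longrightarrow> bender_knuth P r i \<in> carrier G"
  unfolding carrier_BK_group by (blast intro: generate.incl)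

lemma bk_elt_Nil: "bk_elt [] = \<one>\<^bsub>G\<^esub>"
  by (auto simp: bk_elt_def one_G)

lemma bk_elt_in_G: "\<forall>j\<in>set w. Suc j < card P \<Longrightarrow> bk_elt w \<in> carrier G"
proof (induction w)
  case Nil
  then show ?case
    using group_G by (simp add: bk_elt_Nil group.is_monoid monoid.one_closed)
next
  case (Cons j w)
  then have b: "bender_knuth P r j \<in> carrier G" "bk_elt w \<in> carrier G"
    by (auto simp: bender_knuth_in_G)
  moreover have "bk_elt (j # w) = compose L (bk_elt w) (bender_knuth P r j)"
    using Cons.prems by (auto simp: fun_eq_iff bk_elt_def compose_def bender_knuth_eq_bk_step bk_step_in_L)
  ultimately show ?case
    using group_G by (metis group.is_monoid monoid.m_closed mult_G)
qed

lemma bk_elt_apply: "xs \<in> L \<Longrightarrow> bk_elt w xs = fold (bk_step r) w xs"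
  by (simp add: bk_elt_def)

lemma group_action_G: "group_action G L (\<lambda>g. g)"
proof -
  have "(\<lambda>g. g) \<in> hom G (BijGroup L)"
    using carrier_G_subset by (auto simp: hom_def BK_group_def)
  then show ?thesis
    by (simp add: group_action_def group_hom_def group_hom_axioms_def group_G group_BijGroup)
qed

lemma bk_step_adjacent:
  assumes "(x, y) \<notin> r" "(y, x) \<notin> r"
  shows "bk_step r (length us) (us @ x # y # vs) = us @ y # x # vs"
  using assms bk_step_append[of 0 "[x, y]" r us vs] by (simp add: bk_step_def swap_at_def)

lemma bubble_to_front:
  assumes "\<forall>u\<in>set us. (u, x) \<notin> r \<and> (x, u) \<notin> r"
  shows "\<exists>w. (\<forall>j\<in>set w. j < length us) \<and> fold (bk_step r) w (us @ x # vs) = x # us @ vs"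
  using assms
proof (induction us arbitrary: vs rule: rev_induct)
  case (snoc u us)
  then obtain w where "\<forall>j\<in>set w. j < length us"
    "fold (bk_step r) w (us @ x # u # vs) = x # us @ u # vs"
    by force
  moreover have "bk_step r (length us) ((us @ [u]) @ x # vs) = us @ x # u # vs"
    using snoc.prems by (simp add: bk_step_adjacent)
  ultimately show ?case
    by (intro exI[of _ "length us # w"]) auto
qed (auto intro!: exI[of _ "[]"])

text \<open>The first element of the target is bubbled to the front of \<open>xs\<close>, and
  induction treats the rest. Bubbling never gets stuck: what precedes this element in
  \<open>xs\<close> follows it in the target, so the two are incomparable.\<close>

lemma transitive_words:
  assumes "distinct xs" "sorted_wrt (\<lambda>x y. (y, x) \<notin> r) xs"
    and "distinct ys" "sorted_wrt (\<lambda>x y. (y, x) \<notin> r) ys" and "set xs = set ys"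
  shows "\<exists>w. (\<forall>j\<in>set w. Suc j < length xs) \<and> fold (bk_step r) w xs = ys"
  using assms
proof (induction ys arbitrary: xs)
  case Nil
  then show ?case
    by (intro exI[of _ "[]"]) auto
next
  case (Cons y ys)
  then obtain us vs where xs: "xs = us @ y # vs"
    by (metis list.set_intros(1) split_list)
  have us: "set us \<subseteq> set ys"
    using Cons.prems(1,3,5) unfolding xs by auto
  have "\<forall>u\<in>set us. (u, y) \<notin> r \<and> (y, u) \<notin> r"
    using Cons.prems(2,4) us unfolding xs by (auto simp: sorted_wrt_append)
  then obtain w1 where w1: "\<forall>j\<in>set w1. j < length us"
    "fold (bk_step r) w1 xs = y # us @ vs"
    unfolding xs using bubble_to_front by blast
  have "set (us @ vs) = set ys"
    using Cons.prems(1,3,5) unfolding xs by auto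
  then obtain w2 where w2: "\<forall>j\<in>set w2. Suc j < length (us @ vs)" "fold (bk_step r) w2 (us @ vs) = ys"
    using Cons.IH[of "us @ vs"] Cons.prems(1-4) unfolding xs
    by (auto simp: sorted_wrt_append)
  have "fold (bk_step r) (map ((+) 1) w2) (y # us @ vs) = y # ys"
    using fold_bk_step_append[of w2 "us @ vs" r "[y]" "[]"] w2 by simp
  then have "fold (bk_step r) (w1 @ map ((+) 1) w2) xs = y # ys"
    using w1 by simp
  moreover have "\<forall>j\<in>set (w1 @ map ((+) 1) w2). Suc j < length xs"
    using w1(1) w2(1) xs by auto
  ultimately show ?case
    by blast
qed

lemma transitive:
  assumes "xs \<in> L" "ys \<in> L"
  obtains w where "\<forall>j\<in>set w. Suc j < card P" "fold (bk_step r) w xs = ys"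
  using transitive_words[of xs ys] assms length_extension[OF assms(1)]
  by (auto simp: linear_extensions_iff_sorted_wrt)

lemma stabilizer_subgroup: "l \<in> L \<Longrightarrow> subgroup (stabilizer G (\<lambda>g. g) l) G"
  using group_action.stabilizer_subgroup[OF group_action_G] .

lemma group_BK_Stab: "l \<in> L \<Longrightarrow> group (BK_Stab P r l)"
  unfolding BK_Stab_def by (rule subgroup.subgroup_is_group[OF stabilizer_subgroup group_G])

lemma stabilizer_size_eq:
  assumes l: "l \<in> L"
  shows "stabilizer_size P r = of_nat (order (BK_Stab P r l))"
proof -
  have "orbit G (\<lambda>g. g) l = L"
  proof (intro equalityI subsetI)
    fix ys
    assume "ys \<in> L"
    then obtain w where "\<forall>j\<in>set w. Suc j < card P" "fold (bk_step r) w l = ys"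
      using transitive[OF l] by blast
    then show "ys \<in> orbit G (\<lambda>g. g) l"
      unfolding orbit_def using bk_elt_in_G[of w] bk_elt_apply[OF l, of w] by (smt (verit) mem_Collect_eq)
  qed (use in_L l in \<open>auto simp: orbit_def\<close>)
  then have "card L * card (stabilizer G (\<lambda>g. g) l) = order G"
    using group_action.orbit_stabilizer_theorem[OF group_action_G l] by simp
  moreover have "card L \<noteq> 0"
    using l finite_L by auto
  ultimately show ?thesis
    unfolding stabilizer_size_def BK_Stab_def order_def
    by (simp add: field_simps flip: of_nat_mult)
qed

end

section \<open>Windows of four elements\<close>

lemma has_subgroup_iso_to_mono:
  assumes G: "group G" "group G'" and T: "group T" and h: "h \<in> hom G G'" "inj_on h (carrier G)"
    and "has_subgroup_iso_to G T"
  shows "has_subgroup_iso_to G' T"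
proof -
  obtain H where H: "subgroup H G" "G\<lparr>carrier := H\<rparr> \<cong> T"
    using assms by (auto simp: has_subgroup_iso_to_def)
  have "group (G\<lparr>carrier := H\<rparr>)"
    using H(1) G(1) by (rule subgroup.subgroup_is_group)
  then obtain k where k: "k \<in> iso T (G\<lparr>carrier := H\<rparr>)"
    using H(2) group.iso_sym unfolding is_iso_def by blast
  have sub: "k x \<in> H" "k x \<in> carrier G" if "x \<in> carrier T" for x
    using k that subgroup.subset[OF H(1)] by (auto simp: iso_def hom_def)
  have "h \<circ> k \<in> hom T G'"
    using k h(1) sub by (auto simp: iso_def hom_def)
  moreover have "inj_on (h \<circ> k) (carrier T)"
  proof (rule comp_inj_on)
    show "inj_on k (carrier T)"
      using k by (auto simp: iso_def bij_betw_def)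
    show "inj_on h (k ` carrier T)"
      using h(2) by (rule inj_on_subset) (use sub in auto)
  qed
  ultimately show ?thesis
    using has_subgroup_iso_toI[OF T G(2)] by blast
qed

section \<open>A finite model of windows\<close>

datatype corner = C0 | C1 | C2 | C3
datatype move = T0 | T1 | T2

text \<open>
  The arguments state the comparability of the pairs 01, 02, 03, 12, 13, 23 of window elements. The
  order relation need not be stored, because the initial window is already a linear extension.
\<close>

definition pattern :: "bool \<Rightarrow> bool \<Rightarrow> bool \<Rightarrow> bool \<Rightarrow> bool \<Rightarrow> bool \<Rightarrow> corner \<Rightarrow> corner \<Rightarrow> bool" where
  "pattern a b c d e f x y = (case x of
     C0 \<Rightarrow> (case y of C0 \<Rightarrow> True | C1 \<Rightarrow> a | C2 \<Rightarrow> b | C3 \<Rightarrow> c)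
   | C1 \<Rightarrow> (case y of C0 \<Rightarrow> a | C1 \<Rightarrow> True | C2 \<Rightarrow> d | C3 \<Rightarrow> e)
   | C2 \<Rightarrow> (case y of C0 \<Rightarrow> b | C1 \<Rightarrow> d | C2 \<Rightarrow> True | C3 \<Rightarrow> f)
   | C3 \<Rightarrow> (case y of C0 \<Rightarrow> c | C1 \<Rightarrow> e | C2 \<Rightarrow> f | C3 \<Rightarrow> True))"

text \<open>Each entry names an element by its place in the initial window, so a state records where
  these four elements are now. Finite types let the checks run by evaluation, for all posets at
  once.\<close>

type_synonym state = "corner \<times> corner \<times> corner \<times> corner"

fun pattern_step :: "(corner \<Rightarrow> corner \<Rightarrow> bool) \<Rightarrow> move \<Rightarrow> state \<Rightarrow> state" where
  "pattern_step M T0 (w,x,y,z) = (if M w x then (w,x,y,z) else (x,w,y,z))"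
| "pattern_step M T1 (w,x,y,z) = (if M x y then (w,x,y,z) else (w,y,x,z))"
| "pattern_step M T2 (w,x,y,z) = (if M y z then (w,x,y,z) else (w,x,z,y))"

abbreviation pattern_run :: "(corner \<Rightarrow> corner \<Rightarrow> bool) \<Rightarrow> move list \<Rightarrow> state" where
  "pattern_run M ms \<equiv> fold (pattern_step M) ms (C0,C1,C2,C3)"

text \<open>
  The words were found by a computer search among the conjugates of the three moves, which are
  the palindromes of odd length. \<open>Lambda_words\<close> is \<open>V_words\<close> with \<open>T0\<close> and \<open>T2\<close> exchanged.
\<close>

definition N_words :: "move list \<times> move list \<times> move list" where
  "N_words = ([T0, T1, T0], [T1],
     [T2, T1, T2, T1, T0, T1, T0, T1, T2, T1, T2, T1, T0, T1, T2, T0, T1, T0, T2, T1, T0, T1, T2, T1, T2, T1, T0, T1, T0, T1, T2, T1, T2])"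

definition V_words :: "move list \<times> move list \<times> move list" where
  "V_words = ([T0, T1, T2, T1, T0, T1, T2, T1, T0], [T0, T1, T0, T1, T0],
     [T2, T1, T2, T0, T1, T2, T0, T1, T2, T0, T1, T2, T1, T0, T1, T2, T1, T0, T2, T1, T0, T2, T1, T0, T2, T1, T2])"

definition Lambda_words :: "move list \<times> move list \<times> move list" where
  "Lambda_words = ([T2, T1, T0, T1, T2, T1, T0, T1, T2], [T2, T1, T2, T1, T2],
     [T0, T1, T0, T2, T1, T0, T2, T1, T0, T2, T1, T0, T1, T2, T1, T0, T1, T2, T0, T1, T2, T0, T1, T2, T0, T1, T0])"

fun A3_relations :: "move list \<times> move list \<times> move list \<Rightarrow> (move list \<times> move list) list" where
  "A3_relations (u, v, w) = [(u @ u, []), (v @ v, []), (w @ w, []),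
     (v @ u @ v, u @ v @ u), (w @ v @ w, v @ w @ v), (u @ w, w @ u)]"

definition satisfies_A3_relations :: "move list \<times> move list \<times> move list \<Rightarrow> (corner \<Rightarrow> corner \<Rightarrow> bool) \<Rightarrow> bool" where
  "satisfies_A3_relations ws M \<longleftrightarrow>
     list_all (\<lambda>(u, v). pattern_run M u = pattern_run M v) (A3_relations ws)"

text \<open>The four implications are transitivity on the triples 012, 013, 023 and 123. They leave
  the 40 orders on the window for which its initial arrangement is a linear extension.\<close>

definition universal_A3 :: "move list \<times> move list \<times> move list \<Rightarrow> bool" where
  "universal_A3 ws \<longleftrightarrow> (\<forall>a\<in>{True,False}. \<forall>b\<in>{True,False}. \<forall>c\<in>{True,False}.
     \<forall>d\<in>{True,False}. \<forall>e\<in>{True,False}. \<forall>f\<in>{True,False}.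
     if (a \<and> d \<longrightarrow> b) \<and> (a \<and> e \<longrightarrow> c) \<and> (b \<and> f \<longrightarrow> c) \<and> (d \<and> f \<longrightarrow> e)
     then satisfies_A3_relations ws (pattern a b c d e f) else True)"

lemma universal_A3D:
  assumes "universal_A3 ws" "a \<and> d \<longrightarrow> b" "a \<and> e \<longrightarrow> c" "b \<and> f \<longrightarrow> c" "d \<and> f \<longrightarrow> e"
  shows "satisfies_A3_relations ws (pattern a b c d e f)"
proof -
  have mem: "x \<in> {True, False}" for x
    by simp
  note assms(1)[unfolded universal_A3_def, THEN bspec, OF mem[of a], THEN bspec, OF mem[of b],
      THEN bspec, OF mem[of c], THEN bspec, OF mem[of d], THEN bspec, OF mem[of e], THEN bspec, OF mem[of f]]
  then show ?thesis
    using assms(2-5) by (simp only: if_True simp_thms)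
qed

text \<open>The words fix the window, so the window itself cannot tell \<open>u\<close> from
  \<open>w\<close>. They are compared after a preliminary move \<open>m\<close>, on a neighbouring
  arrangement.\<close>

definition nondegenerate_A3 :: "move list \<times> move list \<times> move list \<Rightarrow> (corner \<Rightarrow> corner \<Rightarrow> bool) \<Rightarrow> bool" where
  "nondegenerate_A3 ws M \<longleftrightarrow> (case ws of (u, v, w) \<Rightarrow>
     list_all (\<lambda>x. pattern_run M x = (C0,C1,C2,C3)) [u, v, w] \<and>
     list_ex (\<lambda>m. pattern_run M (m # u) \<noteq> pattern_run M (m # w)) [T0, T2])"

lemma nondegenerate_A3_words:
  "nondegenerate_A3 N_words (pattern False True False True True False)"
  "nondegenerate_A3 V_words (pattern False False False True True False)"
  "nondegenerate_A3 Lambda_words (pattern False True False True False False)"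
  by code_simp+

lemma universal_A3_words: "universal_A3 N_words" "universal_A3 V_words" "universal_A3 Lambda_words"
  by code_simp+

fun move_index :: "move \<Rightarrow> nat" where
  "move_index T0 = 0" | "move_index T1 = 1" | "move_index T2 = 2"

fun state_list :: "(corner \<Rightarrow> 'a) \<Rightarrow> state \<Rightarrow> 'a list" where
  "state_list f (w,x,y,z) = [f w, f x, f y, f z]"

definition comparability :: "('a \<times> 'a) set \<Rightarrow> (corner \<Rightarrow> 'a) \<Rightarrow> corner \<Rightarrow> corner \<Rightarrow> bool" where
  "comparability r f x y \<longleftrightarrow> (f x, f y) \<in> r \<or> (f y, f x) \<in> r"

lemma fold_bk_step_state_list:
  "fold (bk_step r) (map move_index ms) (state_list f s) =
     state_list f (fold (pattern_step (comparability r f)) ms s)"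
proof (induction ms arbitrary: s)
  case (Cons m ms)
  obtain w x y z where s: "s = (w,x,y,z)"
    by (cases s)
  have "bk_step r (move_index m) (state_list f s) = state_list f (pattern_step (comparability r f) m s)"
    by (cases m) (auto simp: s bk_step_def swap_at_def comparability_def numeral_2_eq_2)
  then show ?case
    using Cons.IH by simp
qed simp

lemma comparability_eq_pattern:
  assumes "\<And>x. (f x, f x) \<in> r"
  shows "comparability r f = pattern (comparability r f C0 C1) (comparability r f C0 C2)
    (comparability r f C0 C3) (comparability r f C1 C2) (comparability r f C1 C3) (comparability r f C2 C3)"
  using assms by (intro ext) (auto simp: pattern_def comparability_def split: corner.splits)

section \<open>From windows to subgroups of stabilizers\<close>

context finite_poset
begin

abbreviation window_moves :: "nat \<Rightarrow> move list \<Rightarrow> nat list" where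
  "window_moves i ms \<equiv> map ((+) i) (map move_index ms)"

lemma fold_bk_step_window:
  "fold (bk_step r) (window_moves (length us) ms) (us @ state_list f s @ vs) =
     us @ state_list f (fold (pattern_step (comparability r f)) ms s) @ vs"
proof -
  have "\<forall>j\<in>set (map move_index ms). Suc j < length (state_list f s)"
  proof
    fix j
    assume "j \<in> set (map move_index ms)"
    then obtain m where "j = move_index m"
      by auto
    then show "Suc j < length (state_list f s)"
      by (cases m; cases s) auto
  qed
  from fold_bk_step_append[OF this] show ?thesis
    by (simp only: fold_bk_step_state_list)
qed

lemma window_split:
  assumes "xs \<in> L" "i + 3 < card P"
  obtains us f vs where "xs = us @ state_list f (C0,C1,C2,C3) @ vs" "length us = i"
proof -
  let ?ys = "drop i xs"
  have "length ?ys \<ge> 4"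
    using assms length_extension[OF assms(1)] by simp
  then obtain a b c d vs where "?ys = a # b # c # d # vs"
    by (auto simp: Suc_le_length_iff eval_nat_numeral simp del: length_drop)
  then have "xs = take i xs @ [a,b,c,d] @ vs"
    by (metis append_Cons append_Nil append_take_drop_id)
  then show ?thesis
    using that[of "take i xs" "case_corner a b c d" vs] assms length_extension[OF assms(1)] by simp
qed

text \<open>Every linear extension has some window at position \<open>i\<close>, and its
  comparabilities form one of the patterns covered by \<open>universal_A3\<close>. So the relation
  holds in the group, not only near a bad window.\<close>

lemma window_relation:
  assumes ws: "universal_A3 ws" "(u, v) \<in> set (A3_relations ws)" and i: "i + 3 < card P"
  shows "bk_elt (window_moves i u) = bk_elt (window_moves i v)"
  unfolding bk_elt_def
proof (rule restrict_ext)
  fix xs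
  assume xs: "xs \<in> L"
  obtain us f vs where eq: "xs = us @ state_list f (C0,C1,C2,C3) @ vs" "length us = i"
    using window_split[OF xs i] .
  let ?M = "comparability r f"
  have in_P: "f x \<in> P" for x
    using xs by (cases x) (auto simp: eq linear_extensions_iff_sorted_wrt)
  have sorted: "(f C1, f C0) \<notin> r" "(f C2, f C0) \<notin> r" "(f C3, f C0) \<notin> r" "(f C2, f C1) \<notin> r"
    "(f C3, f C1) \<notin> r" "(f C3, f C2) \<notin> r"
    using xs by (auto simp: eq linear_extensions_iff_sorted_wrt sorted_wrt_append)
  \<comment> \<open>Sortedness leaves one possible direction for each comparability, so
    comparability inherits transitivity from \<open>r\<close> along increasing positions.\<close>
  have "?M C0 C1 \<and> ?M C1 C2 \<longrightarrow> ?M C0 C2" "?M C0 C1 \<and> ?M C1 C3 \<longrightarrow> ?M C0 C3"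
    "?M C0 C2 \<and> ?M C2 C3 \<longrightarrow> ?M C0 C3" "?M C1 C2 \<and> ?M C2 C3 \<longrightarrow> ?M C1 C3"
    using sorted trans[of "f C0" "f C1" "f C2"] trans[of "f C0" "f C1" "f C3"]
      trans[of "f C0" "f C2" "f C3"] trans[of "f C1" "f C2" "f C3"]
    by (simp_all add: comparability_def)
  from universal_A3D[OF ws(1) this]
  have "satisfies_A3_relations ws (pattern (?M C0 C1) (?M C0 C2) (?M C0 C3) (?M C1 C2) (?M C1 C3) (?M C2 C3))" .
  then have "satisfies_A3_relations ws ?M"
    by (subst comparability_eq_pattern) (use in_P refl in blast)+
  then have "pattern_run ?M u = pattern_run ?M v"
    using ws(2) by (auto simp: satisfies_A3_relations_def list_all_iff)
  then show "fold (bk_step r) (window_moves i u) xs = fold (bk_step r) (window_moves i v) xs"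
    unfolding eq(1) eq(2)[symmetric] fold_bk_step_window by simp
qed

text \<open>The factors are reversed because \<^const>\<open>fold\<close> starts with the first letter.\<close>

lemma bk_elt_append:
  assumes "\<forall>j\<in>set u. Suc j < card P" "\<forall>j\<in>set v. Suc j < card P"
  shows "bk_elt (u @ v) = bk_elt v \<otimes>\<^bsub>G\<^esub> bk_elt u"
proof -
  have "bk_elt (u @ v) = compose L (bk_elt v) (bk_elt u)"
    using fold_bk_step_in_L assms(1) by (auto simp: bk_elt_def compose_def fun_eq_iff)
  then show ?thesis
    using mult_G bk_elt_in_G assms by simp
qed

lemma BK_Stab_simps:
  "carrier (BK_Stab P r l) = {g \<in> carrier G. g l = l}"
  "x \<otimes>\<^bsub>BK_Stab P r l\<^esub> y = x \<otimes>\<^bsub>G\<^esub> y" "\<one>\<^bsub>BK_Stab P r l\<^esub> = \<one>\<^bsub>G\<^esub>"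
  by (simp_all add: BK_Stab_def stabilizer_def)

text \<open>Conjugation by an element taking \<open>l\<close> to \<open>l'\<close> maps one
  stabilizer into the other.\<close>

lemma has_subgroup_BK_Stab_conjugate:
  assumes l: "l \<in> L" "l' \<in> L" and T: "group T" "has_subgroup_iso_to (BK_Stab P r l') T"
  shows "has_subgroup_iso_to (BK_Stab P r l) T"
proof -
  interpret group G
    by (rule group_G)
  obtain w where w: "\<forall>j\<in>set w. Suc j < card P" "fold (bk_step r) w l = l'"
    using transitive[OF l] .
  define g where "g = bk_elt w"
  have g: "g \<in> carrier G" "g l = l'"
    using w bk_elt_in_G bk_elt_apply l by (auto simp: g_def)
  have ig: "inv\<^bsub>G\<^esub> g \<in> carrier G" "(inv\<^bsub>G\<^esub> g) l' = l"
    using g l group_action.orbit_sym_aux[OF group_action_G, of g l l'] by auto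
  have apply_mult: "(a \<otimes>\<^bsub>G\<^esub> b) xs = a (b xs)" if "a \<in> carrier G" "b \<in> carrier G" "xs \<in> L" for a b xs
    using that by (simp add: mult_G compose_def)
  define c where "c x = inv\<^bsub>G\<^esub> g \<otimes>\<^bsub>G\<^esub> (x \<otimes>\<^bsub>G\<^esub> g)" for x
  have "c x \<otimes>\<^bsub>G\<^esub> c y = c (x \<otimes>\<^bsub>G\<^esub> y)" if "x \<in> carrier G" "y \<in> carrier G" for x y
  proof -
    have "g \<otimes>\<^bsub>G\<^esub> (inv\<^bsub>G\<^esub> g \<otimes>\<^bsub>G\<^esub> z) = z" if "z \<in> carrier G" for z
      using that g ig by (simp flip: m_assoc)
    then show ?thesis
      using that g ig by (simp add: c_def m_assoc)
  qed
  moreover have "c x l = l" "c x \<in> carrier G" if "x \<in> carrier G" "x l' = l'" for x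
    using that g ig l by (simp_all add: c_def apply_mult)
  ultimately have "c \<in> hom (BK_Stab P r l') (BK_Stab P r l)"
    by (auto intro!: homI simp: BK_Stab_simps)
  moreover have "inj_on c (carrier (BK_Stab P r l'))"
    using g ig by (auto intro!: inj_onI simp: BK_Stab_simps c_def)
  ultimately show ?thesis
    using has_subgroup_iso_to_mono[OF group_BK_Stab group_BK_Stab T(1)] l T(2) by blast
qed

text \<open>Universality supplies the Coxeter relations, nondegeneracy puts the generators into the
  stabilizer and keeps two of them apart, and conjugation carries the subgroup over to
  \<open>l\<close>.\<close>

lemma has_subgroup_sym_group_4_window:
  assumes xs: "us @ state_list f (C0,C1,C2,C3) @ vs \<in> L" and l: "l \<in> L"
    and universal_ws: "universal_A3 ws" and nondegenerate: "nondegenerate_A3 ws (comparability r f)"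
  shows "has_subgroup_iso_to (BK_Stab P r l) (sym_group 4)"
proof -
  obtain u v w where ws: "ws = (u, v, w)"
    by (cases ws)
  have "list_all (\<lambda>x. pattern_run (comparability r f) x = (C0,C1,C2,C3)) [u, v, w]"
    and separated: "list_ex (\<lambda>n. pattern_run (comparability r f) (n # u) \<noteq> pattern_run (comparability r f) (n # w)) [T0, T2]"
    using nondegenerate unfolding nondegenerate_A3_def ws prod.case by blast+
  then have fixed: "pattern_run (comparability r f) u = (C0,C1,C2,C3)"
      "pattern_run (comparability r f) v = (C0,C1,C2,C3)"
      "pattern_run (comparability r f) w = (C0,C1,C2,C3)"
    by (simp_all only: list.pred_inject)
  obtain n where ne: "pattern_run (comparability r f) (n # u) \<noteq> pattern_run (comparability r f) (n # w)"
    using separated by (auto simp only: list_ex_iff)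
  note universal = universal_ws[unfolded ws]
  let ?xs = "us @ state_list f (C0,C1,C2,C3) @ vs" and ?i = "length us"
  have i: "?i + 3 < card P"
    using length_extension[OF xs] by simp
  have "move_index m \<le> 2" for m
    by (cases m) auto
  have "Suc (?i + move_index m) < card P" for m
    using i \<open>\<And>m. move_index m \<le> 2\<close>[of m] by linarith
  then have in_range: "\<forall>j\<in>set (window_moves ?i ms). Suc j < card P" for ms
    by auto
  define e where "e ms = bk_elt (window_moves ?i ms)" for ms
  have e_G: "e ms \<in> carrier G" for ms
    unfolding e_def using in_range by (rule bk_elt_in_G)
  have e_append: "e b \<otimes>\<^bsub>G\<^esub> e a = e (a @ b)" for a b
    using bk_elt_append[OF in_range in_range, of a b] by (simp add: e_def)
  have e_Nil: "e [] = \<one>\<^bsub>G\<^esub>"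
    by (simp add: e_def bk_elt_Nil)
  have e_xs: "e ms ?xs = us @ state_list f (pattern_run (comparability r f) ms) @ vs" for ms
    unfolding e_def bk_elt_apply[OF xs] fold_bk_step_window ..
  \<comment> \<open>The locale asks for a family over all natural numbers; indices above 2 get the
    empty word, hence the identity.\<close>
  define s where "s j = e (if j = 0 then u else if j = 1 then v else if j = 2 then w else [])" for j :: nat
  have e_eq: "e a = e b" if "(a, b) \<in> set (A3_relations (u, v, w))" for a b
    unfolding e_def using window_relation[OF universal that i] .
  interpret coxeter_A3 "BK_Stab P r ?xs" s
  proof (intro coxeter_A3.intro coxeter_A3_axioms.intro group_BK_Stab[OF xs])
    show "s j \<in> carrier (BK_Stab P r ?xs)" for j
      using e_G e_xs fixed by (auto simp: s_def BK_Stab_simps)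
    show "s j \<otimes>\<^bsub>BK_Stab P r ?xs\<^esub> s j = \<one>\<^bsub>BK_Stab P r ?xs\<^esub>" for j
      using e_eq[of "u @ u" "[]"] e_eq[of "v @ v" "[]"] e_eq[of "w @ w" "[]"] e_Nil
      by (simp add: s_def BK_Stab_simps e_append)
    \<comment> \<open>The reversal in \<open>e_append\<close> is harmless: the sides of the braid
      relations are palindromes in the generators, and commutation is symmetric.\<close>
    show "s 1 \<otimes>\<^bsub>BK_Stab P r ?xs\<^esub> (s 0 \<otimes>\<^bsub>BK_Stab P r ?xs\<^esub> s 1) =
      s 0 \<otimes>\<^bsub>BK_Stab P r ?xs\<^esub> (s 1 \<otimes>\<^bsub>BK_Stab P r ?xs\<^esub> s 0)"
      using e_eq[of "v @ u @ v" "u @ v @ u"] by (simp add: s_def BK_Stab_simps e_append)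
    show "s 2 \<otimes>\<^bsub>BK_Stab P r ?xs\<^esub> (s 1 \<otimes>\<^bsub>BK_Stab P r ?xs\<^esub> s 2) =
      s 1 \<otimes>\<^bsub>BK_Stab P r ?xs\<^esub> (s 2 \<otimes>\<^bsub>BK_Stab P r ?xs\<^esub> s 1)"
      using e_eq[of "w @ v @ w" "v @ w @ v"] by (simp add: s_def BK_Stab_simps e_append)
    show "s 2 \<otimes>\<^bsub>BK_Stab P r ?xs\<^esub> s 0 = s 0 \<otimes>\<^bsub>BK_Stab P r ?xs\<^esub> s 2"
      using e_eq[of "u @ w" "w @ u"] by (simp add: s_def BK_Stab_simps e_append)
  qed
  have "s 0 \<noteq> s 2"
  proof
    assume "s 0 = s 2"
    \<comment> \<open>The letter \<open>n\<close> acts first and leads to the arrangement on which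
      \<open>u\<close> and \<open>w\<close> differ.\<close>
    then have "e ([n] @ u) = e ([n] @ w)"
      unfolding e_append[symmetric] by (simp add: s_def)
    then have "e (n # u) = e (n # w)"
      by simp
    then have "state_list f (pattern_run (comparability r f) (n # u)) =
        state_list f (pattern_run (comparability r f) (n # w))"
      by (metis e_xs same_append_eq append_same_eq)
    moreover have "inj f"
    proof (rule injI)
      fix x y
      assume "f x = f y"
      then show "x = y"
        using xs by (cases x; cases y) (auto simp: linear_extensions_iff_sorted_wrt)
    qed
    ultimately have "pattern_run (comparability r f) (n # u) = pattern_run (comparability r f) (n # w)"
      by (cases "pattern_run (comparability r f) (n # u)"; cases "pattern_run (comparability r f) (n # w)")
        (auto simp: inj_eq)
    then show False
      using ne by simp
  qed
  then have "has_subgroup_iso_to (BK_Stab P r ?xs) (sym_group 4)"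
    by (rule has_subgroup_sym_group_4)
  then show ?thesis
    using has_subgroup_BK_Stab_conjugate[OF l xs sym_group_is_group] by blast
qed

lemma comparability_window:
  assumes "us @ [a,b,c,d] @ vs \<in> L"
  shows "comparability r (case_corner a b c d) =
    pattern ((a,b) \<in> r) ((a,c) \<in> r) ((a,d) \<in> r) ((b,c) \<in> r) ((b,d) \<in> r) ((c,d) \<in> r)"
proof -
  have "(case_corner a b c d x, case_corner a b c d x) \<in> r" for x
    using assms by (cases x) (auto intro: refl simp: linear_extensions_iff_sorted_wrt)
  then show ?thesis
    by (subst comparability_eq_pattern)
      (use assms in \<open>auto simp: comparability_def linear_extensions_iff_sorted_wrt sorted_wrt_append\<close>)
qed

lemma N_window:
  assumes "us @ [a,b,c,d] @ vs \<in> L" "l \<in> L"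
    and "(a,b) \<notin> r" "(a,c) \<in> r" "(a,d) \<notin> r" "(b,c) \<in> r" "(b,d) \<in> r" "(c,d) \<notin> r"
  shows "has_subgroup_iso_to (BK_Stab P r l) (sym_group 4)"
  using has_subgroup_sym_group_4_window[of us "case_corner a b c d" vs l N_words] assms
    universal_A3_words nondegenerate_A3_words comparability_window[OF assms(1)] by simp

lemma V_window:
  assumes "us @ [a,b,c,d] @ vs \<in> L" "l \<in> L"
    and "(a,b) \<notin> r" "(a,c) \<notin> r" "(a,d) \<notin> r" "(b,c) \<in> r" "(b,d) \<in> r" "(c,d) \<notin> r"
  shows "has_subgroup_iso_to (BK_Stab P r l) (sym_group 4)"
  using has_subgroup_sym_group_4_window[of us "case_corner a b c d" vs l V_words] assms
    universal_A3_words nondegenerate_A3_words comparability_window[OF assms(1)] by simp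

lemma Lambda_window:
  assumes "us @ [a,b,c,d] @ vs \<in> L" "l \<in> L"
    and "(a,b) \<notin> r" "(a,c) \<in> r" "(a,d) \<notin> r" "(b,c) \<in> r" "(b,d) \<notin> r" "(c,d) \<notin> r"
  shows "has_subgroup_iso_to (BK_Stab P r l) (sym_group 4)"
  using has_subgroup_sym_group_4_window[of us "case_corner a b c d" vs l Lambda_words] assms
    universal_A3_words nondegenerate_A3_words comparability_window[OF assms(1)] by simp

end

section \<open>Ordinal cuts\<close>

definition forbids_bad_windows :: "'a set \<Rightarrow> ('a \<times> 'a) set \<Rightarrow> bool" where
  "forbids_bad_windows P r \<longleftrightarrow> (\<forall>us a b c d vs. us @ [a,b,c,d] @ vs \<in> linear_extensions P r \<longrightarrow>
     \<not> ((a,b) \<notin> r \<and> (a,c) \<in> r \<and> (a,d) \<notin> r \<and> (b,c) \<in> r \<and> (b,d) \<in> r \<and> (c,d) \<notin> r) \<and>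
     \<not> ((a,b) \<notin> r \<and> (a,c) \<notin> r \<and> (a,d) \<notin> r \<and> (b,c) \<in> r \<and> (b,d) \<in> r \<and> (c,d) \<notin> r) \<and>
     \<not> ((a,b) \<notin> r \<and> (a,c) \<in> r \<and> (a,d) \<notin> r \<and> (b,c) \<in> r \<and> (b,d) \<notin> r \<and> (c,d) \<notin> r))"

lemma linear_extensions_converse:
  "xs \<in> linear_extensions P (r\<inverse>) \<longleftrightarrow> rev xs \<in> linear_extensions P r"
  by (simp add: linear_extensions_iff_sorted_wrt sorted_wrt_rev)

text \<open>Reversing a window turns an N into an N and exchanges the other two types. Results on
  branching upwards thereby apply to branching downwards.\<close>

lemma forbids_bad_windows_converse:
  assumes "forbids_bad_windows P r"
  shows "forbids_bad_windows P (r\<inverse>)"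
  unfolding forbids_bad_windows_def
proof (intro allI impI)
  fix us vs and a b c d :: 'a
  assume "us @ [a,b,c,d] @ vs \<in> linear_extensions P (r\<inverse>)"
  then have "rev vs @ [d,c,b,a] @ rev us \<in> linear_extensions P r"
    by (simp add: linear_extensions_converse)
  from assms[unfolded forbids_bad_windows_def, rule_format, OF this]
  show "\<not> ((a,b) \<notin> r\<inverse> \<and> (a,c) \<in> r\<inverse> \<and> (a,d) \<notin> r\<inverse> \<and> (b,c) \<in> r\<inverse> \<and> (b,d) \<in> r\<inverse> \<and> (c,d) \<notin> r\<inverse>) \<and>
     \<not> ((a,b) \<notin> r\<inverse> \<and> (a,c) \<notin> r\<inverse> \<and> (a,d) \<notin> r\<inverse> \<and> (b,c) \<in> r\<inverse> \<and> (b,d) \<in> r\<inverse> \<and> (c,d) \<notin> r\<inverse>) \<and>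
     \<not> ((a,b) \<notin> r\<inverse> \<and> (a,c) \<in> r\<inverse> \<and> (a,d) \<notin> r\<inverse> \<and> (b,c) \<in> r\<inverse> \<and> (b,d) \<notin> r\<inverse> \<and> (c,d) \<notin> r\<inverse>)"
    unfolding converse_iff by blast
qed

text \<open>The lower part of an ordinal sum decomposition. The empty set and \<open>P\<close> are
  allowed; they separate no two elements of \<open>P\<close>.\<close>

definition cut :: "'a set \<Rightarrow> ('a \<times> 'a) set \<Rightarrow> 'a set \<Rightarrow> bool" where
  "cut P r D \<longleftrightarrow> D \<subseteq> P \<and> (\<forall>x\<in>D. \<forall>y\<in>P - D. (x, y) \<in> r)"

lemma cut_converse: "cut P (r\<inverse>) D \<Longrightarrow> cut P r (P - D)"
  by (auto simp: cut_def)

context finite_poset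
begin

lemma converse: "finite_poset P (r\<inverse>)"
  using finite_P partial_order by (simp add: finite_poset_def)

text \<open>The first later \<open>u\<close> not above \<open>x\<close> is not above anything in
  between either, since all of that lies above \<open>x\<close>. So \<open>u\<close> can be moved in
  front of \<open>x\<close>, where it is isolated in the window \<open>u x y z\<close>.\<close>

lemma V_below_later:
  assumes good: "forbids_bad_windows P r" and xs: "us @ [x,y,z] @ vs \<in> L"
    and V: "(x,y) \<in> r" "(x,z) \<in> r" "(y,z) \<notin> r"
  shows "\<forall>q\<in>set vs. (x,q) \<in> r"
proof (rule ccontr)
  assume "\<not> (\<forall>q\<in>set vs. (x,q) \<in> r)"
  then obtain vs1 u vs2 where vs: "vs = vs1 @ u # vs2" "(x,u) \<notin> r" "\<forall>v\<in>set vs1. (x,v) \<in> r"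
    using split_list_first_prop[of vs "\<lambda>q. (x,q) \<notin> r"] by auto
  have "(v,u) \<notin> r" if "v \<in> set vs1 \<union> {x,y,z}" for v
    using that vs(2,3) V(1,2) trans[of x v u] by auto
  then have "us @ [u,x,y,z] @ vs1 @ vs2 \<in> L"
    using xs unfolding linear_extensions_iff_sorted_wrt vs(1)
    by (auto simp: sorted_wrt_append)
  moreover have "(u,x) \<notin> r" "(u,y) \<notin> r" "(u,z) \<notin> r"
    using xs unfolding linear_extensions_iff_sorted_wrt vs by (auto simp: sorted_wrt_append)
  ultimately show False
    using good V unfolding forbids_bad_windows_def by blast
qed

text \<open>The cut consists of \<open>x\<close> and everything before it. An earlier
  \<open>p\<close> violating this can be brought next to \<open>x\<close>, where it forms a bad
  window or takes over the role of \<open>x\<close>.\<close>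

lemma V_cut:
  assumes good: "forbids_bad_windows P r" and xs: "us @ [x,y,z] @ vs \<in> L"
    and V: "(x,y) \<in> r" "(x,z) \<in> r" "(y,z) \<notin> r"
  shows "\<exists>D. cut P r D \<and> x \<in> D \<and> y \<notin> D \<and> z \<notin> D"
proof -
  have x_below: "\<forall>q\<in>{y,z} \<union> set vs. (x,q) \<in> r"
    using V_below_later[OF assms] V by auto
  have us_below: "\<forall>p\<in>set us. \<forall>q\<in>{y,z} \<union> set vs. (p,q) \<in> r"
  proof (rule ccontr)
    assume "\<not> ?thesis"
    then have "\<exists>p\<in>set us. \<exists>q\<in>{y,z} \<union> set vs. (p,q) \<notin> r"
      by blast
    \<comment> \<open>For the last such \<open>p\<close>, all of \<open>us2\<close> lies below
      everything after \<open>x\<close>; so \<open>p\<close> is below none of \<open>us2\<close> and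
      can pass it.\<close>
    then obtain us1 p us2 where us: "us = us1 @ p # us2" and p: "\<exists>q\<in>{y,z} \<union> set vs. (p,q) \<notin> r"
      and us2: "\<forall>p\<in>set us2. \<forall>q\<in>{y,z} \<union> set vs. (p,q) \<in> r"
      using split_list_last_prop[of us "\<lambda>p. \<exists>q\<in>{y,z} \<union> set vs. (p,q) \<notin> r"] by blast
    have not_below: "(p,u) \<notin> r" if "u \<in> set us2 \<union> {x}" for u
      using that p us2 x_below trans by blast
    have perm: "us1 @ us2 @ [x] @ [p,y,z] @ vs \<in> L" "us1 @ us2 @ [p,x,y,z] @ vs \<in> L"
      using xs not_below unfolding linear_extensions_iff_sorted_wrt us
      by (auto simp: sorted_wrt_append)
    have perm': "us1 @ us2 @ [p,x,z,y] @ vs \<in> L" 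
      using perm(2) V(3) unfolding linear_extensions_iff_sorted_wrt us
      by (auto simp: sorted_wrt_append)
    have zy: "(z,y) \<notin> r"
      using xs by (auto simp: linear_extensions_iff_sorted_wrt sorted_wrt_append)
    have px: "(p,x) \<notin> r"
      using not_below by simp
    consider "(p,y) \<in> r" "(p,z) \<in> r" | "(p,y) \<in> r" "(p,z) \<notin> r" | "(p,y) \<notin> r" "(p,z) \<in> r"
      | "(p,y) \<notin> r" "(p,z) \<notin> r"
      by blast
    then show False
    proof cases
      case 1
      \<comment> \<open>Placed after \<open>x\<close>, the element \<open>p\<close> forms a V with
        \<open>y\<close> and \<open>z\<close> itself.\<close>
      have "\<forall>q\<in>set vs. (p,q) \<in> r"
        by (rule V_below_later[OF good, of "us1 @ us2 @ [x]"]) (use perm 1 V in auto)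
      then show False
        using p 1 by auto
    next
      \<comment> \<open>The remaining cases are bad windows: an N, an N with \<open>y\<close> and
        \<open>z\<close> exchanged, and a V with isolated point \<open>p\<close>.\<close>
      case 2
      then show False
        using good perm(2)[folded append_assoc[of us1 us2]] px V unfolding forbids_bad_windows_def by blast
    next
      case 3
      then show False
        using good perm'[folded append_assoc[of us1 us2]] px V zy unfolding forbids_bad_windows_def by blast
    next
      case 4
      then show False
        using good perm(2)[folded append_assoc[of us1 us2]] px V unfolding forbids_bad_windows_def by blast
    qed
  qed
  have "cut P r (set us \<union> {x})"
    using xs x_below us_below unfolding cut_def linear_extensions_iff_sorted_wrt by auto
  moreover have "y \<notin> set us \<union> {x}" "z \<notin> set us \<union> {x}"
    using xs by (auto simp: linear_extensions_iff_sorted_wrt)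
  ultimately show ?thesis
    by blast
qed

lemma cut_downward: "cut P r D \<Longrightarrow> (x,y) \<in> r \<Longrightarrow> y \<in> D \<Longrightarrow> x \<in> D"
  using antisym in_carrier unfolding cut_def by blast

text \<open>The three elements need not be close to each other in an extension. They are replaced by
  \<open>x'\<close> above \<open>x\<close> and covers \<open>y'\<close>, \<open>z'\<close> of
  \<open>x'\<close> below \<open>y\<close> and \<open>z\<close>; a cut separating these also
  separates the original elements, because cuts are closed downwards.\<close>

lemma branching_cut:
  assumes good: "forbids_bad_windows P r" and l: "l \<in> L"
    and V: "(x,y) \<in> r" "(x,z) \<in> r" "(y,z) \<notin> r" "(z,y) \<notin> r"
  shows "\<exists>D. cut P r D \<and> x \<in> D \<and> y \<notin> D \<and> z \<notin> D"
proof -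
  let ?lt = "\<lambda>a b. (a, b) \<in> r \<and> a \<noteq> b"
  have asymp: "asymp_on A ?lt" for A
    by (rule asymp_onI) (use antisym in metis)
  have transp: "transp_on A ?lt" for A
    by (rule transp_onI) (use antisym trans in metis)
  \<comment> \<open>Nothing strictly above a maximal element \<open>x'\<close> of \<open>X\<close>
    lies below both \<open>y\<close> and \<open>z\<close>; this makes the covers chosen later
    incomparable.\<close>
  define X where "X = {w. (x,w) \<in> r \<and> (w,y) \<in> r \<and> (w,z) \<in> r}"
  have "X \<subseteq> P" "x \<in> X"
    using in_carrier V(1,2) refl unfolding X_def by auto
  then have "finite X" "X \<noteq> {}"
    using finite_P finite_subset by auto
  then obtain x' where x': "x' \<in> X" "\<And>w. w \<in> X \<Longrightarrow> w \<noteq> x' \<Longrightarrow> \<not> ?lt x' w"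
    using Finite_Set.bex_max_element[OF _ asymp transp] by metis
  have cover: "\<exists>b'. ?lt x' b' \<and> (b',b) \<in> r \<and> (\<forall>w. ?lt x' w \<and> (w,b') \<in> r \<longrightarrow> w = b')"
    if "?lt x' b" for b
  proof -
    define Y where "Y = {w. ?lt x' w \<and> (w,b) \<in> r}"
    have "Y \<subseteq> P" 
      using in_carrier(1) unfolding Y_def by blast
    moreover have "b \<in> Y"
      using that in_carrier(2) refl unfolding Y_def by blast
    ultimately have "finite Y" "Y \<noteq> {}"
      using finite_P finite_subset by auto
    then have "\<exists>b'\<in>Y. \<forall>w\<in>Y. w \<noteq> b' \<longrightarrow> \<not> ?lt w b'"
      using Finite_Set.bex_min_element[OF _ asymp transp] by blast
    then obtain b' where "b' \<in> Y" and minimal: "\<forall>w\<in>Y. w \<noteq> b' \<longrightarrow> \<not> ?lt w b'"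
      by blast
    then have b': "?lt x' b'" "(b',b) \<in> r"
      unfolding Y_def by blast+
    have "w = b'" if "?lt x' w" "(w,b') \<in> r" for w
      using minimal b'(2) that trans[of w b' b] unfolding Y_def by blast
    then show ?thesis
      using b' by blast
  qed
  have "?lt x' y" "?lt x' z"
    using x'(1) V unfolding X_def by auto
  obtain y' where y': "?lt x' y'" "(y',y) \<in> r" "\<And>w. ?lt x' w \<Longrightarrow> (w,y') \<in> r \<Longrightarrow> w = y'"
    using cover[OF \<open>?lt x' y\<close>] by blast
  obtain z' where z': "?lt x' z'" "(z',z) \<in> r" "\<And>w. ?lt x' w \<Longrightarrow> (w,z') \<in> r \<Longrightarrow> w = z'"
    using cover[OF \<open>?lt x' z\<close>] by blast
  have xx': "(x,x') \<in> r"
    using x'(1) unfolding X_def by auto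
  have "(y',z) \<notin> r"
    using x'(2)[of y'] y'(1,2) trans[OF xx', of y'] unfolding X_def by auto
  then have y'_z': "(y',z') \<notin> r"
    using trans[OF _ z'(2)] by auto
  have "(z',y) \<notin> r"
    using x'(2)[of z'] z'(1,2) trans[OF xx', of z'] unfolding X_def by auto
  then have z'_y': "(z',y') \<notin> r"
    using trans[OF _ y'(2)] by auto
  \<comment> \<open>Covering allows \<open>x'\<close>, \<open>y'\<close>, \<open>z'\<close> to be
    consecutive: nothing outside the triple that lies under \<open>y'\<close> or \<open>z'\<close>
    is above \<open>x'\<close>, so all of it can be placed in front.\<close>
  define below where "below w \<longleftrightarrow> ((w,y') \<in> r \<or> (w,z') \<in> r) \<and> w \<notin> {x',y',z'}" for w
  define above where "above w \<longleftrightarrow> (w,y') \<notin> r \<and> (w,z') \<notin> r" for w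
  have *: "(x',w) \<notin> r" "(y',w) \<notin> r" "(z',w) \<notin> r" if w: "below w" for w
  proof -
    show "(x',w) \<notin> r"
      using w y'(3)[of w] z'(3)[of w] unfolding below_def by auto
    show "(y',w) \<notin> r"
      using w y'_z' antisym[of y' w] trans[of y' w z'] unfolding below_def by auto
    show "(z',w) \<notin> r"
      using w z'_y' antisym[of z' w] trans[of z' w y'] unfolding below_def by auto
  qed
  have **: "(w,x') \<notin> r" "(w,y') \<notin> r" "(w,z') \<notin> r" if "above w" for w
    using that y'(1) trans[of w x' y'] unfolding above_def by auto
  have ***: "(v,w) \<notin> r" if "above v" "below w" for v w
    using that trans[of v w] unfolding above_def below_def by auto
  have in_P: "x' \<in> P" "y' \<in> P" "z' \<in> P"
    using y' z' in_carrier by blast+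
  have distinct: "x' \<noteq> y'" "x' \<noteq> z'" "y' \<noteq> z'"
    using y'(1) z'(1) y'_z' in_P refl by auto
  have disjoint: "\<not> above w" "\<not> below w" if "w \<in> {x',y',z'}" for w
    using that in_P refl y'(1) unfolding above_def below_def by auto
  have "\<not> above w" if "below w" for w
    using that unfolding above_def below_def by auto
  moreover have "set l = P"
    using l by (simp add: linear_extensions_iff_sorted_wrt)
  moreover have "below w \<or> above w \<or> w \<in> {x',y',z'}" for w
    unfolding below_def above_def by auto
  ultimately have "set (filter below l @ [x',y',z'] @ filter above l) = P"
      "distinct (filter below l @ [x',y',z'] @ filter above l)"
    using l in_P distinct disjoint by (auto simp: linear_extensions_iff_sorted_wrt)
  moreover have "(y',x') \<notin> r" "(z',x') \<notin> r"
    using y'(1) z'(1) antisym by blast+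
  then have "sorted_wrt (\<lambda>x y. (y,x) \<notin> r) (filter below l @ [x',y',z'] @ filter above l)"
    using l z'_y' * ** *** unfolding linear_extensions_iff_sorted_wrt
    by (auto simp: sorted_wrt_append sorted_wrt_filter)
  ultimately have "filter below l @ [x',y',z'] @ filter above l \<in> L"
    unfolding linear_extensions_iff_sorted_wrt by blast
  then obtain D where D: "cut P r D" "x' \<in> D" "y' \<notin> D" "z' \<notin> D"
    using V_cut[OF good] y'(1) z'(1) y'_z' by blast
  then show ?thesis
    using cut_downward[OF D(1)] xx' y'(2) z'(2) by blast
qed

end

section \<open>Stabilizers in the absence of bad windows\<close>

locale good_poset = finite_poset +
  fixes l :: "'a list"
  assumes l: "l \<in> L" and good: "forbids_bad_windows P r"
begin

text \<open>The chains of the ordinal sum, described without constructing the decomposition. A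
  summand that is a single chain falls apart into points, since cuts pass between its
  elements.\<close>

definition sim :: "'a \<Rightarrow> 'a \<Rightarrow> bool" (infix \<open>\<sim>\<close> 50) where
  "x \<sim> y \<longleftrightarrow> ((x,y) \<in> r \<or> (y,x) \<in> r) \<and> (\<forall>D. cut P r D \<longrightarrow> (x \<in> D \<longleftrightarrow> y \<in> D))"

lemma sim_refl: "x \<in> P \<Longrightarrow> x \<sim> x"
  by (simp add: sim_def refl)

lemma sim_sym: "x \<sim> y \<Longrightarrow> y \<sim> x"
  by (auto simp: sim_def)

lemma merging_cut:
  assumes "(y,x) \<in> r" "(z,x) \<in> r" "(y,z) \<notin> r" "(z,y) \<notin> r"
  shows "\<exists>D. cut P r D \<and> x \<notin> D \<and> y \<in> D \<and> z \<in> D"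
proof -
  have "rev l \<in> linear_extensions P (r\<inverse>)"
    using l by (simp add: linear_extensions_converse)
  then obtain D where "cut P (r\<inverse>) D" "x \<in> D" "y \<notin> D" "z \<notin> D"
    using finite_poset.branching_cut[OF converse forbids_bad_windows_converse[OF good]] assms by blast
  then show ?thesis
    using cut_converse[of P r D] assms in_carrier by blast
qed

text \<open>Only two elements on the same side of \<open>y\<close> are in question. If they were
  incomparable, a cut would separate them from \<open>y\<close>.\<close>

lemma sim_trans:
  assumes "x \<sim> y" "y \<sim> z"
  shows "x \<sim> z"
proof -
  have D: "x \<in> D \<longleftrightarrow> y \<in> D" "y \<in> D \<longleftrightarrow> z \<in> D" if "cut P r D" for D
    using that assms unfolding sim_def by blast+
  consider "(x,y) \<in> r" "(y,z) \<in> r" | "(y,x) \<in> r" "(y,z) \<in> r" | "(x,y) \<in> r" "(z,y) \<in> r" | "(z,y) \<in> r" "(y,x) \<in> r"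
    using assms unfolding sim_def by blast
  then have "(x,z) \<in> r \<or> (z,x) \<in> r"
  proof cases
    case 2
    then show ?thesis
      using branching_cut[OF good l, of y x z] D by blast
  next
    case 3
    then show ?thesis
      using merging_cut[of x y z] D by blast
  qed (use trans[of x y z] trans[of z y x] in auto)
  then show ?thesis
    using D unfolding sim_def by blast
qed

lemma nth_in_P: "xs \<in> L \<Longrightarrow> i < card P \<Longrightarrow> xs ! i \<in> P"
  using length_extension[of xs] by (auto simp: linear_extensions_iff_sorted_wrt)

lemma nth_not_greater: "xs \<in> L \<Longrightarrow> i < j \<Longrightarrow> j < card P \<Longrightarrow> (xs ! j, xs ! i) \<notin> r"
  using length_extension[of xs] by (auto simp: linear_extensions_iff_sorted_wrt sorted_wrt_iff_nth_less)

lemma nth_inj: "xs \<in> L \<Longrightarrow> i < card P \<Longrightarrow> j < card P \<Longrightarrow> xs ! i = xs ! j \<longleftrightarrow> i = j"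
  using length_extension[of xs] by (auto simp: linear_extensions_iff_sorted_wrt nth_eq_iff_index_eq)

lemma cut_nth:
  assumes D: "cut P r D" and xs: "xs \<in> L" and i: "i < card P"
  shows "xs ! i \<in> D \<longleftrightarrow> i < card D"
proof -
  define A where "A = {i. i < card P \<and> xs ! i \<in> D}"
  have down: "j \<in> A" if "i \<in> A" "j < i" for i j
  proof -
    have "xs ! j \<in> D"
    proof (rule ccontr)
      assume "xs ! j \<notin> D"
      then have "(xs ! i, xs ! j) \<in> r"
        using D that nth_in_P[OF xs, of j] unfolding cut_def A_def by auto
      then show False
        using nth_not_greater[OF xs that(2)] that(1) unfolding A_def by auto
    qed
    then show ?thesis
      using that by (auto simp: A_def)
  qed
  have "bij_betw ((!) xs) A D"
    unfolding bij_betw_def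
  proof
    show "inj_on ((!) xs) A"
      using nth_inj[OF xs] by (auto simp: A_def inj_on_def)
    have "set xs = P"
      using xs by (simp add: linear_extensions_iff_sorted_wrt)
    then show "(!) xs ` A = D"
      using D length_extension[OF xs] unfolding A_def cut_def
      by (fastforce simp: in_set_conv_nth image_iff subset_iff)
  qed
  then have "card A = card D"
    by (rule bij_betw_same_card)
  moreover have "finite A"
    by (simp add: A_def)
  have "A \<subseteq> {..<card A}"
  proof
    fix i
    assume "i \<in> A"
    then have "{..i} \<subseteq> A"
      using down le_neq_implies_less by blast
    then have "card {..i} \<le> card A"
      using \<open>finite A\<close> card_mono by blast
    then show "i \<in> {..<card A}"
      by simp
  qed
  then have "A = {..<card A}"
    by (simp add: card_subset_eq)
  ultimately show ?thesis
    using i unfolding A_def by auto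
qed

text \<open>The condition for the move to differ from the identity; the reverse comparability cannot
  occur in a linear extension.\<close>

definition active :: "nat \<Rightarrow> bool" where
  "active i \<longleftrightarrow> Suc i < card P \<and> (\<exists>xs\<in>L. (xs ! i, xs ! Suc i) \<notin> r)"

text \<open>Otherwise take the last \<open>d\<close> in the first part that is not below all of the
  second, and then the first \<open>u\<close> there that is not above \<open>d\<close>. Both can be
  moved to the border, where they are incomparable, so the move would be active.\<close>

lemma inactive_cut:
  assumes m: "Suc m < card P" "\<not> active m"
  shows "cut P r (set (take (Suc m) l))"
proof -
  define as bs where "as = take (Suc m) l" and "bs = drop (Suc m) l"
  have l_eq: "l = as @ bs" and len: "length as = Suc m"
    using m(1) length_extension[OF l] by (auto simp: as_def bs_def)
  have "\<forall>d\<in>set as. \<forall>u\<in>set bs. (d,u) \<in> r"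
  proof (rule ccontr)
    assume "\<not> ?thesis"
    then obtain a1 d a2 where as: "as = a1 @ d # a2" and "\<exists>u\<in>set bs. (d,u) \<notin> r"
      and a2: "\<forall>a\<in>set a2. \<forall>u\<in>set bs. (a,u) \<in> r"
      using split_list_last_prop[of as "\<lambda>d. \<exists>u\<in>set bs. (d,u) \<notin> r"] by blast
    then obtain b1 u b2 where bs: "bs = b1 @ u # b2" and du: "(d,u) \<notin> r"
      and b1: "\<forall>b\<in>set b1. (d,b) \<in> r"
      using split_list_first_prop[of bs "\<lambda>u. (d,u) \<notin> r"] by blast
    have "(d,a) \<notin> r" if "a \<in> set a2" for a
      using that a2 du trans[of d a u] bs by auto
    moreover have "(b,u) \<notin> r" if "b \<in> set b1" for b
      using that b1 du trans[of d b u] by auto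
    ultimately have ys: "a1 @ a2 @ [d,u] @ b1 @ b2 \<in> L" (is "?ys \<in> L")
      using l unfolding l_eq as bs linear_extensions_iff_sorted_wrt
      by (auto simp: sorted_wrt_append)
    have "length (a1 @ a2) = m"
      using len as by simp
    then have "?ys ! m = d" "?ys ! Suc m = u"
      using nth_append_length_plus[of "a1 @ a2" "[d,u] @ b1 @ b2" 0]
        nth_append_length_plus[of "a1 @ a2" "[d,u] @ b1 @ b2" 1] by simp_all
    then show False
      using m du ys unfolding active_def by metis
  qed
  then show ?thesis
    using l l_eq unfolding cut_def as_def[symmetric] linear_extensions_iff_sorted_wrt by auto
qed

text \<open>At the first difference, the entry of either list occurs later in the other one. Being
  comparable, each of the two entries is then below the other.\<close>

lemma eq_if_nth_sim:
  assumes "xs \<in> L" "ys \<in> L" "\<And>i. i < card P \<Longrightarrow> xs ! i \<sim> ys ! i"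
  shows "xs = ys"
proof -
  have later: "(xs ! i, ys ! i) \<in> r"
    if "xs \<in> L" "ys \<in> L" "i < card P" "\<And>j. j < i \<Longrightarrow> xs ! j = ys ! j" "xs ! i \<sim> ys ! i" for xs ys i
  proof -
    have "ys ! i \<in> set xs"
      using nth_in_P[OF that(2,3)] that(1) by (simp add: linear_extensions_iff_sorted_wrt)
    then have "\<exists>k<card P. xs ! k = ys ! i"
      using length_extension[OF that(1)] by (metis in_set_conv_nth)
    then obtain k where k: "k < card P" "xs ! k = ys ! i"
      by blast
    have "\<not> k < i"
      using that(4)[of k] k nth_inj[OF that(2), of k i] that(3) by auto
    then have "k = i \<or> i < k"
      by auto
    then show ?thesis
      using k that(5) nth_not_greater[OF that(1), of i k] refl nth_in_P[OF that(2,3)]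
      unfolding sim_def by auto
  qed
  have "xs ! i = ys ! i" if "i < card P" for i
    using that
  proof (induction i rule: less_induct)
    case (less i)
    then have "\<And>j. j < i \<Longrightarrow> xs ! j = ys ! j"
      by simp
    then have "(xs ! i, ys ! i) \<in> r" "(ys ! i, xs ! i) \<in> r"
      using later[of xs ys i] later[of ys xs i] less.prems assms sim_sym by auto
    then show ?case
      by (rule antisym)
  qed
  then show ?thesis
    using length_extension assms by (auto intro: nth_equalityI)
qed

text \<open>
  The permutation describes the action on the words of chain labels: the label at position \<open>i\<close> moves
  to position \<open>p i\<close>. The elements themselves may move differently within their chain.
\<close>

definition realizes :: "(nat \<Rightarrow> nat) \<Rightarrow> ('a list \<Rightarrow> 'a list) \<Rightarrow> bool" where
  "realizes p g \<longleftrightarrow> p permutes {..<card P} \<and> g \<in> carrier G \<and>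
     (\<forall>xs\<in>L. \<forall>i<card P. g xs ! p i \<sim> xs ! i)"

section \<open>Group elements as permutations of label words\<close>

lemma apply_mult_G:
  assumes "g \<in> carrier G" "h \<in> carrier G" "xs \<in> L"
  shows "(g \<otimes>\<^bsub>G\<^esub> h) xs = g (h xs)"
  using assms by (simp add: mult_G compose_def)

lemma realizes_comp:
  assumes "realizes p g" "realizes q h"
  shows "realizes (p \<circ> q) (g \<otimes>\<^bsub>G\<^esub> h)"
proof -
  have g: "g \<in> carrier G" "h \<in> carrier G" and perm: "p permutes {..<card P}" "q permutes {..<card P}"
    using assms by (auto simp: realizes_def)
  have "(g \<otimes>\<^bsub>G\<^esub> h) xs ! (p \<circ> q) i \<sim> xs ! i" if "xs \<in> L" "i < card P" for xs i
  proof -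
    have "q i < card P"
      using permutes_in_image[OF perm(2), of i] that by simp
    then have "g (h xs) ! p (q i) \<sim> h xs ! q i" "h xs ! q i \<sim> xs ! i"
      using assms that in_L[OF g(2)] unfolding realizes_def by blast+
    then show ?thesis
      using sim_trans apply_mult_G[OF g that(1)] by simp
  qed
  moreover have "g \<otimes>\<^bsub>G\<^esub> h \<in> carrier G"
    using g group_G by (simp add: group.is_monoid monoid.m_closed)
  ultimately show ?thesis
    unfolding realizes_def using permutes_compose[OF perm(2,1)] by blast
qed

lemma realizes_one: "realizes id \<one>\<^bsub>G\<^esub>"
  unfolding realizes_def using group_G sim_refl nth_in_P
  by (auto simp: one_G group.is_monoid intro: permutes_id) (metis group.is_monoid monoid.one_closed one_G)

text \<open>When the move does nothing, its two comparable entries must carry the same label. A cut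
  between them would have size \<open>Suc i\<close> and make these positions comparable in every
  extension, contrary to \<open>active i\<close>.\<close>

lemma realizes_active:
  assumes i: "active i"
  shows "realizes (transpose i (Suc i)) (bender_knuth P r i)"
proof -
  have i': "i < card P" "Suc i < card P"
    using i by (auto simp: active_def)
  have "bender_knuth P r i xs ! transpose i (Suc i) k \<sim> xs ! k" if xs: "xs \<in> L" and k: "k < card P" for xs k
  proof (cases "(xs ! i, xs ! Suc i) \<in> r")
    case False
    then have "bender_knuth P r i xs = xs[i := xs ! Suc i, Suc i := xs ! i]"
      using nth_not_greater[OF xs lessI i'(2)] xs by (simp add: bender_knuth_def)
    then have "bender_knuth P r i xs ! transpose i (Suc i) k = xs ! k"
      using i' k length_extension[OF xs] by (auto simp: transpose_def nth_list_update)
    then show ?thesis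
      using sim_refl nth_in_P[OF xs k] by simp
  next
    case True
    then have fixed: "bender_knuth P r i xs = xs"
      using xs by (simp add: bender_knuth_def)
    have "xs ! i \<sim> xs ! Suc i"
      unfolding sim_def
    proof (intro conjI allI impI)
      fix D
      assume D: "cut P r D"
      show "xs ! i \<in> D \<longleftrightarrow> xs ! Suc i \<in> D"
      proof (rule ccontr)
        assume "\<not> ?thesis"
        then have "card D = Suc i"
          using cut_nth[OF D xs i'(1)] cut_nth[OF D xs i'(2)] by auto
        then have "(ys ! i, ys ! Suc i) \<in> r" if "ys \<in> L" for ys
          using that D cut_nth[OF D that i'(1)] cut_nth[OF D that i'(2)] nth_in_P[OF that i'(2)]
          unfolding cut_def by auto
        then show False
          using i by (auto simp: active_def)
      qed
    qed (use True in simp)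
    then show ?thesis
      using fixed sim_sym sim_refl nth_in_P[OF xs k] by (auto simp: transpose_def)
  qed
  then show ?thesis
    unfolding realizes_def using i' bender_knuth_in_G permutes_swap_id[of i "{..<card P}" "Suc i"] by auto
qed

lemma realizes_inactive:
  assumes i: "Suc i < card P" "\<not> active i"
  shows "realizes id (bender_knuth P r i)"
proof -
  have "bender_knuth P r i xs = xs" if "xs \<in> L" for xs
    using that i by (auto simp: active_def bender_knuth_def)
  then show ?thesis
    unfolding realizes_def using i bender_knuth_in_G sim_refl nth_in_P permutes_id by auto
qed

lemma realizes_exists:
  assumes "g \<in> carrier G"
  shows "\<exists>p. realizes p g"
  using assms unfolding carrier_BK_group
proof (induction rule: generate.induct)
  case one
  then show ?case
    using realizes_one by (auto simp: BK_group_def)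
next
  case (incl h)
  then show ?case
    using realizes_active realizes_inactive by blast
next
  case (inv h)
  then obtain i where i: "h = bender_knuth P r i" "Suc i < card P"
    by blast
  have "h \<otimes>\<^bsub>BijGroup L\<^esub> h = \<one>\<^bsub>BijGroup L\<^esub>"
    using bender_knuth_in_BijGroup[OF i(2)] bender_knuth_involution[OF _ i(2)]
    by (auto simp: BijGroup_def i(1) compose_def)
  then have "inv\<^bsub>BijGroup L\<^esub> h = h"
    using bender_knuth_in_BijGroup[OF i(2)] i(1) by (simp add: group.inv_equality group_BijGroup)
  then show ?case
    using i realizes_active realizes_inactive by metis
next
  case (eng g h)
  then obtain p q where "realizes p g" "realizes q h"
    by blast
  then have "realizes (p \<circ> q) (g \<otimes>\<^bsub>G\<^esub> h)"
    by (rule realizes_comp)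
  then show ?case
    by (auto simp: BK_group_def)
qed

section \<open>Permutations of positions that keep the label word of \<open>l\<close>\<close>

definition class_perms :: "(nat \<Rightarrow> nat) set" where
  "class_perms = {p. p permutes {..<card P} \<and> (\<forall>i<card P. l ! p i \<sim> l ! i)}"

lemma active_between:
  assumes "j \<le> m" "m < k" "k < card P" "l ! j \<sim> l ! k"
  shows "active m"
proof (rule ccontr)
  assume "\<not> active m"
  then have D: "cut P r (set (take (Suc m) l))" (is "cut P r ?D")
    using inactive_cut assms by simp
  have len: "length l = card P" and dist: "distinct l"
    using l length_extension by (auto simp: linear_extensions_iff_sorted_wrt)
  have card_D: "card ?D = Suc m"
    using assms len dist by (simp add: distinct_card)
  show False
    using cut_nth[OF D l, of j] cut_nth[OF D l, of k] assms card_D D unfolding sim_def by auto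
qed

text \<open>Since \<open>g\<close> maps onto \<open>L\<close>, the positions \<open>p i\<close> and
  \<open>q i\<close> carry equal labels in every extension; two distinct positions cannot do
  so.\<close>

lemma class_perms_unique:
  assumes p: "p \<in> class_perms" "realizes p g" and q: "q \<in> class_perms" "realizes q g"
  shows "p = q"
proof -
  have perm: "p permutes {..<card P}" "q permutes {..<card P}"
    using p q by (auto simp: class_perms_def)
  have g: "g \<in> carrier G"
    using p by (simp add: realizes_def)
  have sim_all: "ys ! p i \<sim> ys ! q i" if ys: "ys \<in> L" and i: "i < card P" for ys i
  proof -
    have "g ` L = L"
      using g carrier_G_subset by (auto simp: BijGroup_def Bij_def bij_betw_def)
    then obtain xs where "xs \<in> L" "ys = g xs"
      using ys by (auto elim: imageE[of ys g L])
    then show ?thesis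
      using p(2) q(2) i sim_trans sim_sym unfolding realizes_def by metis
  qed
  \<comment> \<open>Beyond the adjacent case, exchanging incomparable entries at \<open>j\<close>
    and \<open>Suc j\<close> leaves position \<open>k\<close> alone, so both entries would share its
    label and be comparable.\<close>
  have separated: False if jk: "j < k" "k < card P" "\<And>ys. ys \<in> L \<Longrightarrow> ys ! j \<sim> ys ! k" for j k
  proof -
    have "active j"
      using active_between[of j j k] jk l by auto
    then obtain ys where ys: "ys \<in> L" "(ys ! j, ys ! Suc j) \<notin> r" and j: "Suc j < card P"
      by (auto simp: active_def)
    have rev: "(ys ! Suc j, ys ! j) \<notin> r"
      using nth_not_greater[OF ys(1) _ j] by simp
    show False
    proof (cases "k = Suc j")
      case True
      then show False
        using jk(3)[OF ys(1)] ys(2) rev by (auto simp: sim_def)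
    next
      case False
      let ?zs = "bender_knuth P r j ys"
      have zs: "?zs \<in> L" "?zs = ys[j := ys ! Suc j, Suc j := ys ! j]"
        using bender_knuth_in_linear_extensions[OF ys(1) j] ys rev by (simp_all add: bender_knuth_def)
      then have "?zs ! j = ys ! Suc j" "?zs ! k = ys ! k"
        using False jk j length_extension[OF ys(1)] by (simp_all add: nth_list_update)
      then have "ys ! Suc j \<sim> ys ! j"
        using jk(3)[OF ys(1)] jk(3)[OF zs(1)] sim_trans sim_sym by metis
      then show False
        using ys(2) rev by (auto simp: sim_def)
    qed
  qed
  show ?thesis
  proof
    fix i
    show "p i = q i"
    proof (cases "i < card P")
      case True
      then have "p i < card P" "q i < card P"
        using permutes_in_image[OF perm(1), of i] permutes_in_image[OF perm(2), of i] by auto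
      then show ?thesis
        using separated[of "p i" "q i"] separated[of "q i" "p i"] sim_all[OF _ True] sim_sym
        by (metis linorder_neqE_nat)
    next
      case False
      then show ?thesis
        using perm by (auto simp: permutes_def)
    qed
  qed
qed

lemma realizes_transpose:
  assumes "j \<le> k" "k < card P" "\<And>m. j \<le> m \<Longrightarrow> m < k \<Longrightarrow> active m"
  shows "\<exists>g. realizes (transpose j k) g"
  using assms
proof (induction k)
  case 0
  then have "transpose j 0 = id"
    by simp
  then show ?case
    using realizes_one by metis
next
  case (Suc k)
  consider "j = Suc k" | "j = k" | "j < k"
    using Suc.prems(1) by linarith
  then show ?case
  proof cases
    case 1
    then have "transpose j (Suc k) = id"
      by simp
    then show ?thesis
      using realizes_one by metis
  next
    case 2
    then show ?thesis
      using realizes_active Suc.prems by blast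
  next
    case 3
    then obtain g where g: "realizes (transpose j k) g"
      using Suc by auto
    have t: "realizes (transpose k (Suc k)) (bender_knuth P r k)"
      using realizes_active Suc.prems 3 by auto
    have "transpose k (Suc k) \<circ> transpose j k \<circ> transpose k (Suc k) = transpose j (Suc k)"
      using 3 by (auto simp: fun_eq_iff transpose_def)
    then show ?thesis
      using realizes_comp[OF realizes_comp[OF t g] t] by metis
  qed
qed

text \<open>Induction on the number of moved points: composing with the transposition of
  \<open>a\<close> and \<open>p a\<close> fixes \<open>a\<close> and moves no new point. The
  transposition is realized because all moves between two positions of a class are active.\<close>

lemma realizes_class_perms:
  assumes "p \<in> class_perms"
  shows "\<exists>g. realizes p g"
  using assms
proof (induction "card {i. p i \<noteq> i}" arbitrary: p rule: less_induct)
  case less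
  then have perm: "p permutes {..<card P}" and sim_p: "\<And>i. i < card P \<Longrightarrow> l ! p i \<sim> l ! i"
    by (auto simp: class_perms_def)
  show ?case
  proof (cases "p = id")
    case True
    then show ?thesis
      using realizes_one by blast
  next
    case False
    then obtain a where a: "p a \<noteq> a"
      by (auto simp: fun_eq_iff)
    then have a': "a < card P" "p a < card P"
      using permutes_in_image[OF perm, of a] perm by (auto simp: permutes_def)
    let ?t = "transpose a (p a)"
    have t: "?t permutes {..<card P}"
      using a' by (simp add: permutes_swap_id)
    have t_sim: "l ! ?t i \<sim> l ! i" if "i < card P" for i
    proof -
      consider "i = a" | "i = p a" | "i \<noteq> a" "i \<noteq> p a"
        by blast
      then show ?thesis
        using sim_p[OF a'(1)] sim_sym[OF sim_p[OF a'(1)]] sim_refl[OF nth_in_P[OF l that]] by cases simp_all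
    qed
    have "l ! ?t (p i) \<sim> l ! i" if "i < card P" for i
      using sim_trans[OF t_sim sim_p[OF that]] permutes_in_image[OF perm, of i] that by simp
    then have class_perms_mem: "?t \<circ> p \<in> class_perms"
      using permutes_compose[OF perm t] by (simp add: class_perms_def)
    have "(?t \<circ> p) i = i" if "p i = i" for i
    proof -
      have "i \<noteq> a" "i \<noteq> p a"
        using that a permutes_inj[OF perm] by (auto dest: injD)
      then show ?thesis
        using that by simp
    qed
    then have "{i. (?t \<circ> p) i \<noteq> i} \<subseteq> {i. p i \<noteq> i}"
      by blast
    moreover have "a \<in> {i. p i \<noteq> i} - {i. (?t \<circ> p) i \<noteq> i}"
      using a by simp
    ultimately have "{i. (?t \<circ> p) i \<noteq> i} \<subset> {i. p i \<noteq> i}"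
      by blast
    moreover have "finite {i. p i \<noteq> i}"
      by (rule finite_subset[of _ "{..<card P}"]) (use perm in \<open>auto simp: permutes_def\<close>)
    ultimately have "card {i. (?t \<circ> p) i \<noteq> i} < card {i. p i \<noteq> i}"
      by (meson psubset_card_mono)
    then obtain g where g: "realizes (?t \<circ> p) g"
      using less class_perms_mem by blast
    have "\<exists>h. realizes ?t h"
    proof (cases "a \<le> p a")
      case True
      then show ?thesis
        using realizes_transpose[of a "p a"] active_between[of a _ "p a"] sim_p[OF a'(1)] sim_sym a' by blast
    next
      case False
      then have "\<exists>h. realizes (transpose (p a) a) h"
        using realizes_transpose[of "p a" a] active_between[of "p a" _ a] sim_p[OF a'(1)] a' by auto
      then show ?thesis
        by (simp add: transpose_commute)
    qed
    then obtain h where "realizes ?t h"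
      by blast
    then have "realizes (?t \<circ> (?t \<circ> p)) (h \<otimes>\<^bsub>G\<^esub> g)"
      using g by (rule realizes_comp)
    moreover have "?t \<circ> (?t \<circ> p) = p"
      by (simp add: fun_eq_iff)
    ultimately show ?thesis
      by auto
  qed
qed

definition class_perm_group :: "(nat \<Rightarrow> nat) monoid" where
  "class_perm_group = sym_group (card P)\<lparr>carrier := class_perms\<rparr>"

definition realization :: "(nat \<Rightarrow> nat) \<Rightarrow> 'a list \<Rightarrow> 'a list" where
  "realization p = (SOME g. realizes p g)"

lemma realizes_realization: "p \<in> class_perms \<Longrightarrow> realizes p (realization p)"
  unfolding realization_def using realizes_class_perms by (rule someI_ex)

text \<open>Labels determine an extension, and \<open>p\<close> determines the labels of the image.
  So the choice in \<open>realization\<close> is forced, which makes it multiplicative.\<close>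

lemma realizes_determines:
  assumes "realizes p g" "realizes p h"
  shows "g = h"
proof (rule eq_in_G)
  show g: "g \<in> carrier G" "h \<in> carrier G"
    using assms by (auto simp: realizes_def)
  fix xs
  assume xs: "xs \<in> L"
  show "g xs = h xs"
  proof (rule eq_if_nth_sim)
    fix i
    assume "i < card P"
    moreover have perm: "p permutes {..<card P}"
      using assms by (simp add: realizes_def)
    ultimately obtain j where "i = p j" "j < card P"
      using permutes_image[OF perm] by (metis imageE lessThan_iff)
    then show "g xs ! i \<sim> h xs ! i"
      using assms xs sim_trans sim_sym unfolding realizes_def by metis
  qed (use in_L g xs in auto)
qed

lemma comp_in_class_perms: 
  assumes "p \<in> class_perms" "q \<in> class_perms"
  shows "p \<circ> q \<in> class_perms"
proof -
  have perm: "p permutes {..<card P}" "q permutes {..<card P}"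
    using assms by (auto simp: class_perms_def)
  have "l ! p (q i) \<sim> l ! i" if "i < card P" for i
    using that assms permutes_in_image[OF perm(2), of i] sim_trans unfolding class_perms_def by fastforce
  then show ?thesis
    using permutes_compose[OF perm(2,1)] by (simp add: class_perms_def)
qed

lemma realization_hom: "realization \<in> hom class_perm_group (BK_Stab P r l)"
proof (rule homI)
  fix p
  assume "p \<in> carrier class_perm_group"
  then have p: "p \<in> class_perms"
    by (simp add: class_perm_group_def)
  let ?g = "realization p"
  have g: "?g \<in> carrier G" "realizes p ?g" and perm: "p permutes {..<card P}"
    using realizes_realization[OF p] by (auto simp: realizes_def)
  have "?g l = l"
  proof (rule eq_if_nth_sim)
    fix i
    assume "i < card P"
    then obtain j where j: "i = p j" "j < card P"
      using permutes_image[OF perm] by (metis imageE lessThan_iff)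
    have "?g l ! p j \<sim> l ! j"
      using g(2) l j(2) by (simp add: realizes_def)
    moreover have "l ! p j \<sim> l ! j"
      using p j(2) by (simp add: class_perms_def)
    ultimately show "?g l ! i \<sim> l ! i"
      unfolding j(1) using sim_trans[OF _ sim_sym] by blast
  next
    show "?g l \<in> L"
      using g(1) l by (rule in_L)
  qed (rule l)
  then show "?g \<in> carrier (BK_Stab P r l)"
    using g by (simp add: BK_Stab_simps)
next
  fix p q
  assume "p \<in> carrier class_perm_group" "q \<in> carrier class_perm_group"
  then have "p \<in> class_perms" "q \<in> class_perms"
    by (auto simp: class_perm_group_def sym_group_def)
  then have "realization (p \<circ> q) = realization p \<otimes>\<^bsub>G\<^esub> realization q"
    using realizes_determines[OF realizes_realization realizes_comp] comp_in_class_perms realizes_realization by simp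
  then show "realization (p \<otimes>\<^bsub>class_perm_group\<^esub> q) = realization p \<otimes>\<^bsub>BK_Stab P r l\<^esub> realization q"
    by (simp add: BK_Stab_simps class_perm_group_def sym_group_def)
qed

text \<open>Each group element realizes some permutation; if it fixes \<open>l\<close>, that
  permutation preserves the labels of \<open>l\<close>. So the stabilizer is a Young
  subgroup.\<close>

lemma realization_bij: "bij_betw realization class_perms (carrier (BK_Stab P r l))"
  unfolding bij_betw_def
proof
  show "inj_on realization class_perms"
    using class_perms_unique realizes_realization by (metis inj_onI)
  show "realization ` class_perms = carrier (BK_Stab P r l)"
  proof
    show "realization ` class_perms \<subseteq> carrier (BK_Stab P r l)"
      using realization_hom by (auto simp: hom_def class_perm_group_def sym_group_def)
    show "carrier (BK_Stab P r l) \<subseteq> realization ` class_perms"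
    proof
      fix g
      assume "g \<in> carrier (BK_Stab P r l)"
      then have g: "g \<in> carrier G" "g l = l"
        by (auto simp: BK_Stab_simps)
      then obtain p where p: "realizes p g"
        using realizes_exists by blast
      then have "p \<in> class_perms"
        using g(2) l unfolding realizes_def class_perms_def by force
      then show "g \<in> realization ` class_perms"
        using realizes_determines[OF p realizes_realization] by blast
    qed
  qed
qed

end

section \<open>Orders and subgroups of the stabilizers\<close>

text \<open>Such a permutation splits uniquely into its restrictions to the new block and to the
  union of the others.\<close>

lemma card_permutations_preserving_blocks:
  assumes "finite \<C>" "\<And>C. C \<in> \<C> \<Longrightarrow> finite C" "\<And>C D. C \<in> \<C> \<Longrightarrow> D \<in> \<C> \<Longrightarrow> C \<noteq> D \<Longrightarrow> C \<inter> D = {}"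
  shows "card {p. p permutes \<Union>\<C> \<and> (\<forall>C\<in>\<C>. \<forall>x\<in>C. p x \<in> C)} = (\<Prod>C\<in>\<C>. fact (card C))"
  using assms
proof (induction \<C> rule: finite_induct)
  case empty
  then show ?case
    by simp
next
  case (insert C \<C>)
  let ?U = "\<Union>\<C>"
  define S where "S = {p. p permutes ?U \<and> (\<forall>C\<in>\<C>. \<forall>x\<in>C. p x \<in> C)}"
  define S' where "S' = {p. p permutes \<Union>(insert C \<C>) \<and> (\<forall>D\<in>insert C \<C>. \<forall>x\<in>D. p x \<in> D)}"
  have disj: "x \<notin> ?U" if "x \<in> C" for x
    using insert.prems(2)[of C] insert.hyps(2) that by blast
  have fin: "finite C" "finite ?U"
    using insert by auto
  have "bij_betw (\<lambda>(a, b). a \<circ> b) ({a. a permutes C} \<times> S) S'"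
    unfolding bij_betw_def
  proof
    show "inj_on (\<lambda>(a, b). a \<circ> b) ({a. a permutes C} \<times> S)"
    proof (rule inj_onI, clarify)
      fix a b a' b'
      assume a: "a permutes C" "a' permutes C" and b: "b \<in> S" "b' \<in> S" and eq: "a \<circ> b = a' \<circ> b'"
      have perm: "b permutes ?U" "b' permutes ?U"
        using b by (auto simp: S_def)
      have "a x = a' x \<and> b x = b' x" for x
      proof (cases "x \<in> C")
        case True
        then have "b x = x" "b' x = x"
          using perm disj by (auto simp: permutes_def)
        then show ?thesis
          using fun_cong[OF eq, of x] by simp
      next
        case False
        have "b x \<notin> C" "b' x \<notin> C"
          using False disj permutes_in_image[OF perm(1), of x] permutes_in_image[OF perm(2), of x]
            permutes_not_in[OF perm(1), of x] permutes_not_in[OF perm(2), of x] by metis+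
        then show ?thesis
          using fun_cong[OF eq, of x] a False by (simp add: permutes_not_in)
      qed
      then show "a = a' \<and> b = b'"
        by auto
    qed
    show "(\<lambda>(a, b). a \<circ> b) ` ({a. a permutes C} \<times> S) = S'"
    proof
      show "(\<lambda>(a, b). a \<circ> b) ` ({a. a permutes C} \<times> S) \<subseteq> S'"
      proof clarify
        fix a b
        assume a: "a permutes C" and b: "b \<in> S"
        have perm: "b permutes ?U"
          using b by (auto simp: S_def)
        have "a \<circ> b permutes \<Union>(insert C \<C>)"
          by (rule permutes_compose) (use permutes_subset[OF perm] permutes_subset[OF a] in auto)
        moreover have "(a \<circ> b) x \<in> C" if "x \<in> C" for x
          using that disj[of x] permutes_not_in[OF perm, of x] permutes_in_image[OF a, of x] by simp
        moreover have "(a \<circ> b) x \<in> D" if "D \<in> \<C>" "x \<in> D" for x D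
        proof -
          have "b x \<in> D"
            using b that by (auto simp: S_def)
          moreover have "b x \<notin> C"
            using disj[of "b x"] that(1) calculation by blast
          ultimately show ?thesis
            using permutes_not_in[OF a] by simp
        qed
        ultimately show "a \<circ> b \<in> S'"
          by (auto simp: S'_def)
      qed
      show "S' \<subseteq> (\<lambda>(a, b). a \<circ> b) ` ({a. a permutes C} \<times> S)"
      proof
        fix p
        assume "p \<in> S'"
        then have perm: "p permutes (C \<union> ?U)" and pC: "\<And>x. x \<in> C \<Longrightarrow> p x \<in> C"
          and pD: "\<And>D x. D \<in> \<C> \<Longrightarrow> x \<in> D \<Longrightarrow> p x \<in> D"
          by (auto simp: S'_def)
        define a where "a x = (if x \<in> C then p x else x)" for x
        define b where "b x = (if x \<in> ?U then p x else x)" for x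
        have inj: "inj_on p A" for A
          using permutes_inj[OF perm] by (rule inj_on_subset) simp
        have restr: "bij_betw (\<lambda>x. if x \<in> A then p x else x) A A" if "finite A" "\<And>x. x \<in> A \<Longrightarrow> p x \<in> A" for A
        proof -
          have "p ` A = A"
            using endo_inj_surj[OF that(1) _ inj[of A]] that(2) by blast
          then have "bij_betw p A A"
            using inj by (simp add: bij_betw_def)
          then show ?thesis
            by (simp cong: bij_betw_cong)
        qed
        have "a permutes C"
          using restr[OF fin(1) pC] by (intro bij_imp_permutes) (auto simp: a_def[abs_def])
        moreover have "p x \<in> ?U" if "x \<in> ?U" for x
          using pD that by blast
        then have "b permutes ?U"
          using restr[OF fin(2)] by (intro bij_imp_permutes) (auto simp: b_def[abs_def])
        then have "b \<in> S"
          using pD by (auto simp: S_def b_def)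
        moreover have "p = a \<circ> b"
        proof
          fix x
          have "p x \<notin> C" if "x \<in> ?U"
            using that pD disj by blast
          then show "p x = (a \<circ> b) x"
            using disj[of x] permutes_not_in[OF perm, of x] by (auto simp: a_def b_def)
        qed
        ultimately show "p \<in> (\<lambda>(a, b). a \<circ> b) ` ({a. a permutes C} \<times> S)"
          by (auto intro: image_eqI[of _ _ "(a, b)"])
      qed
    qed
  qed
  then have "card S' = card ({a. a permutes C} \<times> S)"
    by (simp add: bij_betw_same_card)
  also have "\<dots> = fact (card C) * (\<Prod>C\<in>\<C>. fact (card C))"
    using insert fin by (simp add: card_cartesian_product card_permutations S_def)
  finally show ?case
    using insert.hyps by (simp add: S'_def)
qed

lemma group_Z2_Z2_S3:
  "group ((integer_mod_group 2 \<times>\<times> integer_mod_group 2) \<times>\<times> sym_group 3)"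
  by (simp add: DirProd_group sym_group_is_group)

lemma order_Z2_Z2_S3:
  "order ((integer_mod_group 2 \<times>\<times> integer_mod_group 2) \<times>\<times> sym_group 3) = 24"
proof -
  have "card (carrier (sym_group 3)) = 6"
    by (simp add: sym_group_card_carrier fact_numeral)
  then show ?thesis
    by (simp add: order_def card_cartesian_product carrier_integer_mod_group)
qed

lemma order_sym_group_4: "order (sym_group 4) = 24"
  by (simp add: order_def sym_group_card_carrier fact_numeral)

lemma order_dvd_if_has_subgroup_iso_to:
  assumes "group G" "has_subgroup_iso_to G T"
  shows "order T dvd order G"
proof -
  obtain H where H: "subgroup H G" "G\<lparr>carrier := H\<rparr> \<cong> T"
    using assms(2) by (auto simp: has_subgroup_iso_to_def)
  have "card H = card (carrier T)"
    using iso_same_card[OF H(2)] by simp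
  then show ?thesis
    using group.lagrange[OF assms(1) H(1)] by (metis dvd_triv_right order_def)
qed

lemma inj_on_map_permutation:
  assumes "inj_on e A"
  shows "inj_on (map_permutation A e) {p. p permutes A}"
proof (rule inj_onI)
  fix p q
  assume p: "p \<in> {p. p permutes A}" and q: "q \<in> {p. p permutes A}"
    and eq: "map_permutation A e p = map_permutation A e q"
  have "p x = q x" for x
  proof (cases "x \<in> A")
    case True
    then have "e (p x) = e (q x)"
      using map_permutation_apply[OF assms True] eq by metis
    moreover have "p x \<in> A" "q x \<in> A"
      using p q True permutes_in_image by (auto simp: permutes_in_image)
    ultimately show ?thesis
      using assms by (simp add: inj_on_eq_iff)
  qed (use p q in \<open>simp add: permutes_not_in\<close>)
  then show "p = q"
    by auto
qed

lemma obtain_embedding: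
  assumes "n \<le> card C" "finite C"
  obtains e :: "nat \<Rightarrow> nat" and S where "bij_betw e {1..n::nat} S" "S \<subseteq> C"
proof -
  obtain S where S: "S \<subseteq> C" "card S = n" "finite S"
    using obtain_subset_with_card_n[OF assms(1)] by blast
  then obtain e where "bij_betw e {1..n} S"
    using finite_same_card_bij[of "{1..n}" S] by auto
  then show ?thesis
    using that S by blast
qed

section \<open>Classes of positions and the subgroups they give\<close>

context good_poset
begin

definition pos_classes :: "nat set set" where
  "pos_classes = {..<card P} // {(i, j). i < card P \<and> j < card P \<and> l ! i \<sim> l ! j}"

lemma equiv_pos: "equiv {..<card P} {(i, j). i < card P \<and> j < card P \<and> l ! i \<sim> l ! j}"
proof (rule equivI)
  show "refl_on {..<card P} {(i, j). i < card P \<and> j < card P \<and> l ! i \<sim> l ! j}"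
    using sim_refl[OF nth_in_P[OF l]] by (auto simp: refl_on_def)
  show "sym {(i, j). i < card P \<and> j < card P \<and> l ! i \<sim> l ! j}"
    by (rule symI) (auto dest: sim_sym)
  show "trans {(i, j). i < card P \<and> j < card P \<and> l ! i \<sim> l ! j}" (is "trans ?E")
  proof (rule transI)
    fix x y z
    assume "(x, y) \<in> ?E" "(y, z) \<in> ?E"
    then show "(x, z) \<in> ?E"
      using sim_trans[of "l ! x" "l ! y" "l ! z"] by simp
  qed
qed auto

lemma Union_pos_classes: "\<Union>pos_classes = {..<card P}"
  unfolding pos_classes_def by (rule Union_quotient[OF equiv_pos])

lemma finite_pos_classes: "finite pos_classes"
  unfolding pos_classes_def by (rule finite_quotient) auto

lemma finite_pos_class: "C \<in> pos_classes \<Longrightarrow> finite C"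
  by (rule finite_subset[of _ "{..<card P}"]) (use Union_pos_classes in auto)

lemma pos_class_nonempty: "C \<in> pos_classes \<Longrightarrow> C \<noteq> {}"
  unfolding pos_classes_def by (rule in_quotient_imp_non_empty[OF equiv_pos])

lemma pos_classes_disjoint: "C \<in> pos_classes \<Longrightarrow> D \<in> pos_classes \<Longrightarrow> C \<noteq> D \<Longrightarrow> C \<inter> D = {}"
  using quotient_disj[OF equiv_pos, of C D] unfolding pos_classes_def by blast

lemma pos_class_sim:
  assumes "C \<in> pos_classes" "i \<in> C"
  shows "j \<in> C \<longleftrightarrow> j < card P \<and> l ! j \<sim> l ! i"
proof -
  obtain k where k: "C = {(i, j). i < card P \<and> j < card P \<and> l ! i \<sim> l ! j} `` {k}"
    using assms(1) unfolding pos_classes_def by (rule quotientE)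
  then have i: "k < card P" "l ! k \<sim> l ! i"
    using assms(2) by auto
  have "j \<in> C \<longleftrightarrow> j < card P \<and> l ! k \<sim> l ! j"
    using i(1) by (auto simp: k)
  moreover have "l ! k \<sim> l ! j \<longleftrightarrow> l ! j \<sim> l ! i"
  proof
    assume "l ! k \<sim> l ! j"
    from sim_trans[OF sim_sym[OF this] i(2)] show "l ! j \<sim> l ! i" .
  next
    assume "l ! j \<sim> l ! i"
    from sim_trans[OF i(2) sim_sym[OF this]] show "l ! k \<sim> l ! j" .
  qed
  ultimately show ?thesis
    by simp
qed

lemma class_perms_iff: "p \<in> class_perms \<longleftrightarrow> p permutes \<Union>pos_classes \<and> (\<forall>C\<in>pos_classes. \<forall>x\<in>C. p x \<in> C)"
proof -
  have "(\<forall>i<card P. l ! p i \<sim> l ! i) \<longleftrightarrow> (\<forall>C\<in>pos_classes. \<forall>x\<in>C. p x \<in> C)"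
    if perm: "p permutes {..<card P}"
  proof (intro iffI allI ballI impI)
    fix C i
    assume *: "\<forall>i<card P. l ! p i \<sim> l ! i" and C: "C \<in> pos_classes" "i \<in> C"
    have i: "i < card P"
      using C Union_pos_classes by blast
    then have "p i < card P"
      using permutes_in_image[OF perm, of i] by simp
    then show "p i \<in> C"
      using pos_class_sim[OF C, of "p i"] * i by simp
  next
    fix i
    assume *: "\<forall>C\<in>pos_classes. \<forall>x\<in>C. p x \<in> C" and i: "i < card P"
    obtain C where C: "C \<in> pos_classes" "i \<in> C"
      using i Union_pos_classes by blast
    then show "l ! p i \<sim> l ! i"
      using pos_class_sim[OF C, of "p i"] * by simp
  qed
  then show ?thesis
    unfolding class_perms_def Union_pos_classes mem_Collect_eq by (rule conj_cong[OF HOL.refl])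
qed

lemma permutes_in_class_perms:
  assumes "C \<in> pos_classes" "p permutes S" "S \<subseteq> C"
  shows "p \<in> class_perms"
  unfolding class_perms_iff
proof (intro conjI ballI)
  show "p permutes \<Union>pos_classes"
    using assms by (blast intro: permutes_subset)
  fix D x
  assume D: "D \<in> pos_classes" "x \<in> D"
  show "p x \<in> D"
  proof (cases "x \<in> S")
    case True
    then have "C = D"
      using D assms pos_classes_disjoint by blast
    then show ?thesis
      using permutes_in_image[OF assms(2), of x] True assms(3) by blast
  qed (use D assms(2) in \<open>simp add: permutes_not_in\<close>)
qed

lemma order_BK_Stab: "order (BK_Stab P r l) = (\<Prod>C\<in>pos_classes. fact (card C))"
proof -
  have "order (BK_Stab P r l) = card class_perms"
    using bij_betw_same_card[OF realization_bij] by (simp add: order_def)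
  also have "\<dots> = card {p. p permutes \<Union>pos_classes \<and> (\<forall>C\<in>pos_classes. \<forall>x\<in>C. p x \<in> C)}"
    by (simp flip: class_perms_iff)
  also have "\<dots> = (\<Prod>C\<in>pos_classes. fact (card C))"
    by (rule card_permutations_preserving_blocks) (simp_all add: finite_pos_classes finite_pos_class pos_classes_disjoint)
  finally show ?thesis .
qed

lemma has_subgroup_if_embeds_in_class_perms:
  assumes T: "group T" and F: "\<And>x. x \<in> carrier T \<Longrightarrow> F x \<in> class_perms"
    "\<And>x y. x \<in> carrier T \<Longrightarrow> y \<in> carrier T \<Longrightarrow> F (x \<otimes>\<^bsub>T\<^esub> y) = F x \<circ> F y"
    "inj_on F (carrier T)"
  shows "has_subgroup_iso_to (BK_Stab P r l) T"
proof (rule has_subgroup_iso_toI[OF T group_BK_Stab[OF l]])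
  have "F \<in> hom T class_perm_group"
    using F by (auto intro!: homI simp: class_perm_group_def sym_group_def)
  then show "realization \<circ> F \<in> hom T (BK_Stab P r l)"
    using realization_hom by (rule Group.hom_compose)
  show "inj_on (realization \<circ> F) (carrier T)"
  proof (rule comp_inj_on[OF F(3)])
    show "inj_on realization (F ` carrier T)"
      using bij_betw_imp_inj_on[OF realization_bij] by (rule inj_on_subset) (use F(1) in auto)
  qed
qed

lemma has_sym_group_4_if_large_class:
  assumes C: "C \<in> pos_classes" "card C \<ge> 4"
  shows "has_subgroup_iso_to (BK_Stab P r l) (sym_group 4)"
proof -
  obtain e :: "nat \<Rightarrow> nat" and S where e: "bij_betw e {1..4::nat} S" "S \<subseteq> C"
    using obtain_embedding[OF C(2) finite_pos_class[OF C(1)]] .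
  have inj: "inj_on e {1..4}"
    using e by (simp add: bij_betw_def)
  show ?thesis
  proof (rule has_subgroup_if_embeds_in_class_perms[OF sym_group_is_group])
    show "map_permutation {1..4} e p \<in> class_perms" if "p \<in> carrier (sym_group 4)" for p
      using permutes_in_class_perms[OF C(1) map_permutation_permutes[OF e(1)] e(2)] that
      by (simp add: sym_group_def)
    show "map_permutation {1..4} e (p \<otimes>\<^bsub>sym_group 4\<^esub> q) = map_permutation {1..4} e p \<circ> map_permutation {1..4} e q"
      if "p \<in> carrier (sym_group 4)" "q \<in> carrier (sym_group 4)" for p q
      using map_permutation_compose'[OF inj] that by (simp add: sym_group_def)
    show "inj_on (map_permutation {1..4} e) (carrier (sym_group 4))"
      using inj_on_map_permutation[OF inj] by (simp add: sym_group_def)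
  qed
qed

text \<open>A power of a transposition; the exponent is an integer because the elements of
  \<open>integer_mod_group 2\<close> are the integers 0 and 1.\<close>

definition involution_power :: "nat \<Rightarrow> nat \<Rightarrow> int \<Rightarrow> nat \<Rightarrow> nat" where
  "involution_power a b i = (if i = 0 then id else transpose a b)"

text \<open>Two transpositions and a symmetric group on three letters with supports in different
  classes commute and generate their direct product.\<close>

lemma has_Z2_Z2_S3_if_three_classes:
  assumes A: "A \<in> pos_classes" "card A \<ge> 3" and B: "B \<in> pos_classes" "card B \<ge> 2"
    and C: "C \<in> pos_classes" "card C \<ge> 2" and ne: "A \<noteq> B" "A \<noteq> C" "B \<noteq> C"
  shows "has_subgroup_iso_to (BK_Stab P r l) ((integer_mod_group 2 \<times>\<times> integer_mod_group 2) \<times>\<times> sym_group 3)"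
proof -
  obtain e :: "nat \<Rightarrow> nat" and S where e: "bij_betw e {1..3::nat} S" "S \<subseteq> A"
    using obtain_embedding[OF A(2) finite_pos_class[OF A(1)]] .
  have inj: "inj_on e {1..3}"
    using e by (simp add: bij_betw_def)
  obtain b b' where b: "b \<in> B" "b' \<in> B" "b \<noteq> b'"
    using B(2) card_le_Suc0_iff_eq[OF finite_pos_class[OF B(1)]] by fastforce
  obtain c c' where c: "c \<in> C" "c' \<in> C" "c \<noteq> c'"
    using C(2) card_le_Suc0_iff_eq[OF finite_pos_class[OF C(1)]] by fastforce
  have disj: "A \<inter> B = {}" "A \<inter> C = {}" "B \<inter> C = {}"
    using pos_classes_disjoint A B C ne by auto
  have bc: "b \<noteq> c" "b \<noteq> c'" "b' \<noteq> c" "b' \<noteq> c'"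
    using disj b c by auto
  have notS: "b \<notin> S" "b' \<notin> S" "c \<notin> S" "c' \<notin> S"
    using disj b c e by auto
  define m where "m = map_permutation {1..3} e"
  have m_perm: "m p permutes S" if "p permutes {1..3}" for p
    unfolding m_def using map_permutation_permutes[OF e(1) that] .
  define F where "F x = involution_power b b' (fst (fst x)) \<circ> involution_power c c' (snd (fst x)) \<circ> m (snd x)"
    for x :: "(int \<times> int) \<times> (nat \<Rightarrow> nat)"
  have Z2: "carrier (integer_mod_group 2) = {0, 1}"
    by (auto simp: carrier_integer_mod_group)
  have carr: "fst (fst x) \<in> {0,1}" "snd (fst x) \<in> {0,1}" "snd x permutes {1..3}"
    if "x \<in> carrier ((integer_mod_group 2 \<times>\<times> integer_mod_group 2) \<times>\<times> sym_group 3)" for x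
    using that unfolding carrier_DirProd mem_Times_iff sym_group_carrier Z2 by blast+
  have inv_mult: "involution_power u v ((i + j) mod 2) = involution_power u v i \<circ> involution_power u v j"
    if "i \<in> {0,1}" "j \<in> {0,1}" for u v i j
    using that by (auto simp: involution_power_def)
  have commute_BC: "involution_power c c' j (involution_power b b' i x) = involution_power b b' i (involution_power c c' j x)"
    for i j x
    using fun_cong[OF swap_id_independent[of c b b' c'], of x] bc
    by (simp add: involution_power_def)
  have commute_m: "m p (involution_power u v i x) = involution_power u v i (m p x)"
    if "p permutes {1..3}" "u \<notin> S" "v \<notin> S" for p u v i x
  proof -
    note perm = m_perm[OF that(1)]
    have fixed: "m p u = u" "m p v = v"
      using permutes_not_in[OF perm] that(2,3) by blast+
    have "m p x = u \<longleftrightarrow> x = u" "m p x = v \<longleftrightarrow> x = v"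
      using inj_eq[OF permutes_inj[OF perm], of x u] inj_eq[OF permutes_inj[OF perm], of x v] fixed by simp_all
    then show ?thesis
      by (simp add: involution_power_def transpose_def fixed)
  qed
  show ?thesis
  proof (rule has_subgroup_if_embeds_in_class_perms[OF group_Z2_Z2_S3])
    fix x
    assume x: "x \<in> carrier ((integer_mod_group 2 \<times>\<times> integer_mod_group 2) \<times>\<times> sym_group 3)"
    have "involution_power b b' i \<in> class_perms" for i
      unfolding involution_power_def
      using permutes_in_class_perms[OF B(1) _ subset_refl] permutes_id[of B] permutes_swap_id[OF b(1,2)] by simp
    moreover have "involution_power c c' i \<in> class_perms" for i
      unfolding involution_power_def
      using permutes_in_class_perms[OF C(1) _ subset_refl] permutes_id[of C] permutes_swap_id[OF c(1,2)] by simp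
    moreover have "m (snd x) \<in> class_perms"
      using permutes_in_class_perms[OF A(1) m_perm[OF carr(3)[OF x]] e(2)] .
    ultimately show "F x \<in> class_perms"
      unfolding F_def by (intro comp_in_class_perms)
  next
    fix x y
    assume x: "x \<in> carrier ((integer_mod_group 2 \<times>\<times> integer_mod_group 2) \<times>\<times> sym_group 3)"
      and y: "y \<in> carrier ((integer_mod_group 2 \<times>\<times> integer_mod_group 2) \<times>\<times> sym_group 3)"
    have "m (snd x \<circ> snd y) = m (snd x) \<circ> m (snd y)"
      unfolding m_def using map_permutation_compose'[OF inj] carr(3)[OF y] by simp
    then have "F (x \<otimes>\<^bsub>(integer_mod_group 2 \<times>\<times> integer_mod_group 2) \<times>\<times> sym_group 3\<^esub> y) =
       involution_power b b' (fst (fst x)) \<circ> involution_power b b' (fst (fst y)) \<circ>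
       (involution_power c c' (snd (fst x)) \<circ> involution_power c c' (snd (fst y))) \<circ> (m (snd x) \<circ> m (snd y))"
      using inv_mult[OF carr(1)[OF x] carr(1)[OF y]] inv_mult[OF carr(2)[OF x] carr(2)[OF y]]
      by (cases x; cases y; cases "fst x"; cases "fst y") (simp add: F_def sym_group_def)
    also have "\<dots> = F x \<circ> F y"
      by (simp add: fun_eq_iff F_def commute_BC commute_m[OF carr(3)[OF x]] notS)
    finally show "F (x \<otimes>\<^bsub>(integer_mod_group 2 \<times>\<times> integer_mod_group 2) \<times>\<times> sym_group 3\<^esub> y) = F x \<circ> F y" .
  next
    show "inj_on F (carrier ((integer_mod_group 2 \<times>\<times> integer_mod_group 2) \<times>\<times> sym_group 3))"
    proof (rule inj_onI)
      fix x y
      assume x: "x \<in> carrier ((integer_mod_group 2 \<times>\<times> integer_mod_group 2) \<times>\<times> sym_group 3)"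
        and y: "y \<in> carrier ((integer_mod_group 2 \<times>\<times> integer_mod_group 2) \<times>\<times> sym_group 3)"
        and eq: "F x = F y"
      have m_fixes: "m (snd z) u = u"
        if "z \<in> carrier ((integer_mod_group 2 \<times>\<times> integer_mod_group 2) \<times>\<times> sym_group 3)" "u \<notin> S" for z u
        using permutes_not_in[OF m_perm[OF carr(3)[OF that(1)]] that(2)] .
      \<comment> \<open>The values at \<open>b\<close> and \<open>c\<close> reveal the two
        exponents, because the other factors fix the points involved.\<close>
      have Fb: "F z b = (if fst (fst z) = 0 then b else b')" and Fc: "F z c = (if snd (fst z) = 0 then c else c')"
        if "z \<in> carrier ((integer_mod_group 2 \<times>\<times> integer_mod_group 2) \<times>\<times> sym_group 3)" for z
        using m_fixes[OF that] notS bc by (auto simp: F_def involution_power_def transpose_def)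
      have "fst (fst x) = fst (fst y)"
        using Fb[OF x] Fb[OF y] eq b(3) carr(1)[OF x] carr(1)[OF y] by (auto split: if_splits)
      moreover have "snd (fst x) = snd (fst y)"
        using Fc[OF x] Fc[OF y] eq c(3) carr(2)[OF x] carr(2)[OF y] by (auto split: if_splits)
      moreover have "m (snd x) = m (snd y)"
      proof
        fix u
        have inj: "inj (involution_power v w i)" for v w i
          by (rule inj_on_inverseI[of _ "involution_power v w i"]) (simp add: involution_power_def)
        have "involution_power b b' (fst (fst y)) (involution_power c c' (snd (fst y)) (m (snd x) u)) =
            involution_power b b' (fst (fst y)) (involution_power c c' (snd (fst y)) (m (snd y) u))"
          using fun_cong[OF eq, of u] \<open>fst (fst x) = fst (fst y)\<close> \<open>snd (fst x) = snd (fst y)\<close>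
          by (simp add: F_def)
        then show "m (snd x) u = m (snd y) u"
          by (simp add: inj_eq[OF inj])
      qed
      then have "snd x = snd y"
        using inj_on_eq_iff[OF inj_on_map_permutation[OF inj]] carr(3)[OF x] carr(3)[OF y] unfolding m_def by simp
      ultimately show "x = y"
        by (simp add: prod_eq_iff)
    qed
  qed
qed

text \<open>Classes have at most 3 elements, and beside one of size 3 there is at most one other of
  size 2 or 3. The product of factorials is thus a power of 2, or 6, 6 * 2 or 6 * 6.\<close>

lemma dichotomy:
  assumes no_S4: "\<not> has_subgroup_iso_to (BK_Stab P r l) (sym_group 4)"
    and no_Z2: "\<not> has_subgroup_iso_to (BK_Stab P r l) ((integer_mod_group 2 \<times>\<times> integer_mod_group 2) \<times>\<times> sym_group 3)"
  shows "order (BK_Stab P r l) \<in> {6, 12, 36} \<or> (\<exists>k. order (BK_Stab P r l) = 2 ^ k)"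
proof -
  define T where "T k = {C \<in> pos_classes. card C = k}" for k
  have fin: "finite (T k)" for k
    using finite_pos_classes by (simp add: T_def)
  have "1 \<le> card C \<and> card C \<le> 3" if "C \<in> pos_classes" for C
    using has_sym_group_4_if_large_class[OF that] no_S4 finite_pos_class[OF that] pos_class_nonempty[OF that]
    by (auto simp: Suc_le_eq card_gt_0_iff)
  then have split: "pos_classes = T 3 \<union> T 2 \<union> T 1"
    unfolding T_def by force
  have "order (BK_Stab P r l) = (\<Prod>C\<in>T 3 \<union> T 2 \<union> T 1. fact (card C))"
    using order_BK_Stab split by simp
  also have "\<dots> = (\<Prod>C\<in>T 3. fact (card C)) * (\<Prod>C\<in>T 2. fact (card C)) * (\<Prod>C\<in>T 1. fact (card C))"
    using fin by (subst prod.union_disjoint; (subst prod.union_disjoint)?) (auto simp: T_def)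
  also have "\<dots> = 6 ^ card (T 3) * 2 ^ card (T 2)"
    by (simp add: T_def fact_numeral)
  finally have order: "order (BK_Stab P r l) = 6 ^ card (T 3) * 2 ^ card (T 2)" .
  have small: "card (T 3 \<union> T 2 - {A}) \<le> 1" if A: "A \<in> T 3" for A
  proof (rule ccontr)
    assume "\<not> ?thesis"
    then obtain B C where BC: "B \<in> T 3 \<union> T 2 - {A}" "C \<in> T 3 \<union> T 2 - {A}" "B \<noteq> C"
      using fin by (metis One_nat_def card_le_Suc0_iff_eq finite_Diff finite_UnI)
    then have "A \<noteq> B" "A \<noteq> C"
      by blast+
    moreover have "A \<in> pos_classes" "3 \<le> card A" "B \<in> pos_classes" "2 \<le> card B" "C \<in> pos_classes" "2 \<le> card C"
      using A BC(1,2) by (auto simp: T_def)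
    ultimately show False
      using has_Z2_Z2_S3_if_three_classes BC(3) no_Z2 by blast
  qed
  show ?thesis
  proof (cases "T 3 = {}")
    case True
    then show ?thesis
      using order by simp
  next
    case False
    then obtain A where A: "A \<in> T 3"
      by blast
    have "T 3 \<inter> T 2 = {}"
      by (auto simp: T_def)
    then have "card (T 3) + card (T 2) = card (T 3 \<union> T 2)"
      using fin by (simp add: card_Un_disjoint)
    also have "\<dots> = Suc (card (T 3 \<union> T 2 - {A}))"
      using A fin by (metis UnI1 card.remove finite_UnI)
    finally have "card (T 3) + card (T 2) \<le> 2"
      using small[OF A] by simp
    moreover have "card (T 3) \<ge> 1"
      using False fin by (simp add: Suc_le_eq card_gt_0_iff)
    ultimately have "card (T 3) = 1 \<and> card (T 2) = 0 \<or> card (T 3) = 1 \<and> card (T 2) = 1 \<or> card (T 3) = 2 \<and> card (T 2) = 0"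
      by linarith
    then show ?thesis
      using order by auto
  qed
qed

end

theorem theorem5p6:
  fixes P :: "'a set" and r :: "('a \<times> 'a) set" and l :: "'a list"
  assumes "finite P" and "partial_order_on P r"
    and "l \<in> linear_extensions P r"
  shows "(stabilizer_size P r \<notin> {6, 12, 36} \<and> (\<nexists>k::nat. stabilizer_size P r = 2 ^ k) \<longrightarrow>
            has_subgroup_iso_to (BK_Stab P r l)
              ((integer_mod_group 2 \<times>\<times> integer_mod_group 2) \<times>\<times> sym_group 3) \<or>
            has_subgroup_iso_to (BK_Stab P r l) (sym_group 4))
         \<and> (stabilizer_size P r \<in> {6, 12, 36} \<or> (\<exists>k::nat. stabilizer_size P r = 2 ^ k) \<or>
            (\<exists>m::nat. stabilizer_size P r = of_nat (24 * m)))"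
proof -
  interpret finite_poset P r
    using assms(1,2) by unfold_locales
  let ?S = "BK_Stab P r l"
  let ?Z = "(integer_mod_group 2 \<times>\<times> integer_mod_group 2) \<times>\<times> sym_group 3"
  have size: "stabilizer_size P r = of_nat (order ?S)"
    using stabilizer_size_eq[OF assms(3)] .
  show ?thesis
  proof (cases "has_subgroup_iso_to ?S ?Z \<or> has_subgroup_iso_to ?S (sym_group 4)")
    case True
    then have "24 dvd order ?S"
      using order_dvd_if_has_subgroup_iso_to[OF group_BK_Stab[OF assms(3)]] order_Z2_Z2_S3 order_sym_group_4
      by metis
    then obtain m where "order ?S = 24 * m"
      by blast
    then show ?thesis
      using True size by auto
  next
    case False
    have "forbids_bad_windows P r"
      unfolding forbids_bad_windows_def
      using N_window[OF _ assms(3)] V_window[OF _ assms(3)] Lambda_window[OF _ assms(3)] False by blast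
    then interpret good_poset P r l
      using assms(3) by unfold_locales
    consider "order ?S \<in> {6, 12, 36}" | k where "order ?S = 2 ^ k"
      using dichotomy False by blast
    then have "stabilizer_size P r \<in> {6, 12, 36} \<or> (\<exists>k::nat. stabilizer_size P r = 2 ^ k)"
      unfolding size by cases auto
    then show ?thesis
      by blast
  qed
qed

end
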